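(* The problem of computing $\nu_k(G)$, given a bipartite graph $G$ and an integer $k\ge 0$, is solvable in polynomial time.
   Context: Graphs are finite and undirected, without loops or parallel edges. A graph is $k$-edge-colorable if its edges can be assigned colors from a set of $k$ colors so that adjacent edges receive different colors. For an integer $k\ge 0$ and a graph $G$, $\nu_k(G)=\max\{|E(H)| : H \text{ is a } k\text{-edge-colorable subgraph of } G\}$. *)

theory Defs
  imports "HOL-Library.Log_Nat" "HOL-Computational_Algebra.Polynomial"
begin

type_synonym 'a graph = "'a set \<times> 'a set set"

abbreviation verts :: "'a graph \<Rightarrow> 'a set" where "verts \<equiv> fst"
abbreviation edges :: "'a graph \<Rightarrow> 'a set set" where "edges \<equiv> snd"

definition simple_graph :: "'a graph \<Rightarrow> bool" where
  "simple_graph G \<longleftrightarrow>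
     finite (verts G) \<and> (\<forall>e\<in>edges G. e \<subseteq> verts G \<and> card e = 2)"

definition bipartite :: "'a graph \<Rightarrow> bool" where
  "bipartite G \<longleftrightarrow>
     (\<exists>A B. A \<union> B = verts G \<and> A \<inter> B = {} \<and>
        (\<forall>e\<in>edges G. \<exists>a\<in>A. \<exists>b\<in>B. e = {a, b}))"

definition subgraph :: "'a graph \<Rightarrow> 'a graph \<Rightarrow> bool" where
  "subgraph H G \<longleftrightarrow>
     simple_graph H \<and> verts H \<subseteq> verts G \<and> edges H \<subseteq> edges G"

definition edge_colorable :: "nat \<Rightarrow> 'a graph \<Rightarrow> bool" where
  "edge_colorable k G \<longleftrightarrow>
     (\<exists>c :: 'a set \<Rightarrow> nat. c ` edges G \<subseteq> {..<k} \<and>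
        (\<forall>e\<in>edges G. \<forall>f\<in>edges G. e \<noteq> f \<and> e \<inter> f \<noteq> {} \<longrightarrow> c e \<noteq> c f))"

definition nu :: "nat \<Rightarrow> 'a graph \<Rightarrow> nat" where
  "nu k G = Max {card (edges H) | H. subgraph H G \<and> edge_colorable k H}"

text \<open>
  The machine model is the random access machine of Cook and Reckhow (Time bounded
  random access machines, 1973) with logarithmic cost, which is polynomially equivalent
  to the multitape Turing machine. Registers hold natural numbers, so subtraction is
  truncated, and the result is left in register 0 instead of being printed.
\<close>

datatype instr =
    SetConst nat nat
  | Add nat nat nat
  | Sub nat nat nat
  | Load nat nat
  | Store nat nat
  | JumpPos nat nat
  | Read nat

record config =
  pc :: nat
  reg :: "nat \<Rightarrow> nat"
  inp :: "nat list"

fun step :: "instr \<Rightarrow> config \<Rightarrow> config" where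
  "step (SetConst i a) c = c\<lparr>pc := Suc (pc c), reg := (reg c)(i := a)\<rparr>"
| "step (Add i j k) c = c\<lparr>pc := Suc (pc c), reg := (reg c)(i := reg c j + reg c k)\<rparr>"
| "step (Sub i j k) c = c\<lparr>pc := Suc (pc c), reg := (reg c)(i := reg c j - reg c k)\<rparr>"
| "step (Load i j) c = c\<lparr>pc := Suc (pc c), reg := (reg c)(i := reg c (reg c j))\<rparr>"
| "step (Store i j) c = c\<lparr>pc := Suc (pc c), reg := (reg c)(reg c i := reg c j)\<rparr>"
| "step (JumpPos j l) c = c\<lparr>pc := (if reg c j > 0 then l else Suc (pc c))\<rparr>"
| "step (Read i) c =
     (case inp c of
        [] \<Rightarrow> c\<lparr>pc := Suc (pc c), reg := (reg c)(i := 0)\<rparr>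
      | x # xs \<Rightarrow> c\<lparr>pc := Suc (pc c), reg := (reg c)(i := x), inp := xs\<rparr>)"

text \<open>
  The number of binary digits, where \<^term>\<open>0::nat\<close> has one digit
  (the library sets \<^term>\<open>floorlog 2 0\<close> to zero).
\<close>

definition bit_length :: "nat \<Rightarrow> nat" where
  "bit_length x = max 1 (floorlog 2 x)"

fun cost :: "instr \<Rightarrow> config \<Rightarrow> nat" where
  "cost (SetConst i a) c = 1"
| "cost (Add i j k) c = bit_length (reg c j) + bit_length (reg c k)"
| "cost (Sub i j k) c = bit_length (reg c j) + bit_length (reg c k)"
| "cost (Load i j) c = bit_length (reg c j) + bit_length (reg c (reg c j))"
| "cost (Store i j) c = bit_length (reg c i) + bit_length (reg c j)"
| "cost (JumpPos j l) c = bit_length (reg c j)"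
| "cost (Read i) c = (case inp c of [] \<Rightarrow> 1 | x # xs \<Rightarrow> bit_length x)"

text \<open>
  \<open>halts_in P c t c'\<close>: started in \<open>c\<close>, the program \<open>P\<close> reaches the
  halting configuration \<open>c'\<close> (program counter outside \<open>P\<close>) at total cost \<open>t\<close>.
\<close>

inductive halts_in :: "instr list \<Rightarrow> config \<Rightarrow> nat \<Rightarrow> config \<Rightarrow> bool" for P where
  halt: "pc c \<ge> length P \<Longrightarrow> halts_in P c 0 c"
| step: "pc c < length P \<Longrightarrow> halts_in P (step (P ! pc c) c) t c' \<Longrightarrow>
           halts_in P c (cost (P ! pc c) c + t) c'"

definition init_config :: "nat list \<Rightarrow> config" where
  "init_config xs = \<lparr>pc = 0, reg = (\<lambda>_. 0), inp = xs\<rparr>"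

definition input_size :: "nat list \<Rightarrow> nat" where
  "input_size xs = (\<Sum>x\<leftarrow>xs. bit_length x)"

definition poly_time_solvable :: "'i set \<Rightarrow> ('i \<Rightarrow> nat list) \<Rightarrow> ('i \<Rightarrow> nat) \<Rightarrow> bool" where
  "poly_time_solvable I enc f \<longleftrightarrow>
     (\<exists>(P :: instr list) (p :: nat poly). \<forall>x\<in>I. \<exists>t c.
        halts_in P (init_config (enc x)) t c \<and>
        reg c 0 = f x \<and> t \<le> poly p (input_size (enc x)))"

text \<open>
  As usual, the vertices of an input graph are numbered \<open>0, \<dots>, n - 1\<close>. The input
  consists of \<open>k\<close> (as a single number, hence of binary size), \<open>n\<close>, and the rows of
  the adjacency matrix; the bipartition is not part of the input.
\<close>

definition bipartite_instances :: "(nat graph \<times> nat) set" where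
  "bipartite_instances =
     {(G, k). simple_graph G \<and> bipartite G \<and> (\<exists>n. verts G = {..<n})}"

definition encode_instance :: "nat graph \<times> nat \<Rightarrow> nat list" where
  "encode_instance = (\<lambda>(G, k). let n = card (verts G) in
     k # n # [if {i, j} \<in> edges G then 1 else 0. i \<leftarrow> [0..<n], j \<leftarrow> [0..<n]])"

end

theory Submission imports Defs begin

text \<open>
  By Koenig's theorem a bipartite graph is \<open>k\<close>-edge-colorable as soon as all its degrees are at
  most \<open>k\<close>. So \<open>\<nu>\<^sub>k(G)\<close> is the largest number of edges of a subgraph of maximum degree at
  most \<open>k\<close>, which is a flow problem.

  The bipartition does not have to be found. The rows and columns of the adjacency matrix are the
  two classes of the bipartite double cover of \<open>G\<close>, which for bipartite \<open>G\<close> consists of two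
  disjoint copies of \<open>G\<close>. The algorithm therefore maximizes over 0-1 matrices below the adjacency
  matrix whose row and column sums are at most \<open>k\<close>, and the maximum is \<open>2 \<nu>\<^sub>k(G)\<close>
  (\<open>sum_min_load_eq_nu\<close>).

  The maximization is a push-relabel method on the columns. Every row chooses as many of its entries
  as it may, at most \<open>k\<close>; the load of a column is the number of entries chosen in it. Columns
  carry labels. A column \<open>j\<close> of load above \<open>k\<close> tries to pass a chosen entry \<open>(i, j)\<close> on to
  an unchosen entry \<open>(i, l)\<close> of the same row with a smaller label of \<open>l\<close> (\<open>move_valid\<close>);
  when this is impossible its label grows by one (\<open>relabel_valid\<close>). Each step lowers an integer
  potential that starts at \<open>n (n + 1)\<^sup>2\<close>, so there are polynomially many steps. They end when
  all overloaded columns have label \<open>n + 1\<close>. If there are any, one of the values \<open>1, \<dots>, n\<close> is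
  not a label, and the columns above such a gap form a cut (otherwise take the empty cut). It shows
  that \<open>\<Sum>\<^sub>j min (load j) k\<close> is an upper bound for all competing matrices (\<open>final_optimal\<close>). The bound is attained: surplus
  entries of overloaded columns can just be dropped (\<open>trim_columns\<close>).

  On the machine side, structured programs are compiled to jump code, and Hoare triples count
  the executed steps only. That is enough because one step lengthens the largest number in memory
  by at most one bit: the logarithmic cost of \<open>m\<close> steps is at most \<open>2 m (s + m)\<close>, where
  \<open>s\<close> bounds the initial lengths (\<open>run_halts\<close>).
\<close>

section \<open>Koenig's edge coloring theorem\<close>

definition pair_coloring :: "nat \<Rightarrow> ('a \<times> 'b) set \<Rightarrow> ('a \<times> 'b \<Rightarrow> nat) \<Rightarrow> bool" where
  "pair_coloring k E c \<longleftrightarrow> c ` E \<subseteq> {..<k} \<and>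
     (\<forall>x y y'. (x, y) \<in> E \<and> (x, y') \<in> E \<and> c (x, y) = c (x, y') \<longrightarrow> y = y') \<and>
     (\<forall>x x' y. (x, y) \<in> E \<and> (x', y) \<in> E \<and> c (x, y) = c (x', y) \<longrightarrow> x = x')"

lemma missing_color:
  assumes "finite S" "card S < k"
  shows "\<exists>\<alpha><k. \<alpha> \<notin> (f :: 'a \<Rightarrow> nat) ` S"
proof (rule ccontr)
  assume "\<not> ?thesis"
  then have "{..<k} \<subseteq> f ` S" by auto
  then have "k \<le> card (f ` S)" using card_mono[of "f ` S" "{..<k}"] assms(1) by simp
  then show False using card_image_le[OF assms(1), of f] assms(2) by simp
qed

text \<open>
  A Kempe change. The sets \<open>Y\<close> and \<open>X\<close> are reached from \<open>v\<close> by walks that leave the right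
  side along color \<open>\<alpha>\<close> and the left side along color \<open>\<beta>\<close>. Since \<open>v\<close> misses \<open>\<beta>\<close>, an edge with one
  of these colors has either both ends or no end in \<open>X \<union> Y\<close>, so the two colors can be exchanged there.
  A left vertex enters \<open>X\<close> only along color \<open>\<alpha>\<close>, which \<open>u\<close> misses; hence nothing changes at \<open>u\<close>,
  while \<open>v\<close> now misses \<open>\<alpha>\<close>.
\<close>

lemma kempe_swap:
  assumes col: "pair_coloring k E c"
    and u: "\<And>y. (u, y) \<in> E \<Longrightarrow> c (u, y) \<noteq> \<alpha>"
    and v: "\<And>x. (x, v) \<in> E \<Longrightarrow> c (x, v) \<noteq> \<beta>"
    and "\<alpha> < k" "\<beta> < k"
  shows "\<exists>c'. pair_coloring k E c' \<and> (\<forall>y. (u, y) \<in> E \<longrightarrow> c' (u, y) \<noteq> \<alpha>) \<and>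
           (\<forall>x. (x, v) \<in> E \<longrightarrow> c' (x, v) \<noteq> \<alpha>)"
proof -
  define r where "r = {(y, y'). \<exists>x. (x, y) \<in> E \<and> c (x, y) = \<alpha> \<and> (x, y') \<in> E \<and> c (x, y') = \<beta>}"
  define Y where "Y = r\<^sup>* `` {v}"
  define X where "X = {x. \<exists>y\<in>Y. (x, y) \<in> E \<and> c (x, y) = \<alpha>}"
  have range: "c e < k" if "e \<in> E" for e using col that by (auto simp: pair_coloring_def)
  have inj1: "y = y'" if "(x, y) \<in> E" "(x, y') \<in> E" "c (x, y) = c (x, y')" for x y y'
    using col that unfolding pair_coloring_def by blast
  have inj2: "x = x'" if "(x, y) \<in> E" "(x', y) \<in> E" "c (x, y) = c (x', y)" for x x' y
    using col that unfolding pair_coloring_def by blast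
  have vY: "v \<in> Y" by (simp add: Y_def)
  have stepY: "y' \<in> Y" if "y \<in> Y" "(y, y') \<in> r" for y y'
    using that by (auto simp: Y_def intro: rtrancl_into_rtrancl)
  have \<alpha>Y: "y \<in> Y \<longleftrightarrow> x \<in> X" if "(x, y) \<in> E" "c (x, y) = \<alpha>" for x y
    using that inj1 unfolding X_def by auto
  have \<beta>Y: "y \<in> Y \<longleftrightarrow> x \<in> X" if e: "(x, y) \<in> E" "c (x, y) = \<beta>" for x y
  proof
    assume "x \<in> X"
    then show "y \<in> Y" using e stepY unfolding X_def r_def by blast
  next
    assume "y \<in> Y"
    moreover have "y \<noteq> v" using v e by auto
    ultimately obtain z where z: "z \<in> Y" "(z, y) \<in> r"
      unfolding Y_def by (blast elim: rtranclE)
    then obtain x' where x': "(x', z) \<in> E" "c (x', z) = \<alpha>" "(x', y) \<in> E" "c (x', y) = \<beta>"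
      by (auto simp: r_def)
    then have "x' = x" using inj2 e by simp
    then show "x \<in> X" using x' z unfolding X_def by auto
  qed
  define c' where "c' = (\<lambda>(x, y). if y \<in> Y \<and> c (x, y) = \<alpha> then \<beta>
                          else if y \<in> Y \<and> c (x, y) = \<beta> then \<alpha> else c (x, y))"
  have c': "c' (x, y) = (if y \<in> Y \<and> c (x, y) = \<alpha> then \<beta>
              else if y \<in> Y \<and> c (x, y) = \<beta> then \<alpha> else c (x, y))" for x y
    by (simp add: c'_def)
  have "pair_coloring k E c'"
    unfolding pair_coloring_def
  proof (intro conjI allI impI)
    show "c' ` E \<subseteq> {..<k}" using range assms(4,5) by (auto simp: c'_def)
  next
    fix x y y' assume "(x, y) \<in> E \<and> (x, y') \<in> E \<and> c' (x, y) = c' (x, y')"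
    then have E: "(x, y) \<in> E" "(x, y') \<in> E" and eq: "c' (x, y) = c' (x, y')" by auto
    have "c (x, y) = c (x, y')"
      using eq \<alpha>Y[OF E(1)] \<alpha>Y[OF E(2)] \<beta>Y[OF E(1)] \<beta>Y[OF E(2)]
      unfolding c' by (smt (verit))
    then show "y = y'" using inj1 E by simp
  next
    fix x x' y assume "(x, y) \<in> E \<and> (x', y) \<in> E \<and> c' (x, y) = c' (x', y)"
    then have E: "(x, y) \<in> E" "(x', y) \<in> E" and eq: "c' (x, y) = c' (x', y)" by auto
    have "c (x, y) = c (x', y)" using eq unfolding c' by (smt (verit))
    then show "x = x'" using inj2 E by simp
  qed
  moreover have "c' (u, y) \<noteq> \<alpha>" if "(u, y) \<in> E" for y
  proof
    assume "c' (u, y) = \<alpha>"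
    then have "u \<in> X" using u that \<beta>Y by (auto simp: c' split: if_splits)
    then show False using u unfolding X_def by auto
  qed
  moreover have "c' (x, v) \<noteq> \<alpha>" if "(x, v) \<in> E" for x
    using v[OF that] vY by (auto simp: c')
  ultimately show ?thesis by blast
qed

text \<open>
  Edges are inserted one at a time: when \<open>(u, v)\<close> arrives, \<open>u\<close> misses some color \<open>\<alpha>\<close> and \<open>v\<close> misses
  some \<open>\<beta>\<close>, and after a Kempe change both miss \<open>\<alpha>\<close>.
\<close>

lemma koenig_edge_coloring:
  assumes "finite E" "\<And>x. card {y. (x, y) \<in> E} \<le> k" "\<And>y. card {x. (x, y) \<in> E} \<le> k"
  shows "\<exists>c. pair_coloring k E c"
  using assms
proof (induction E rule: finite_induct)
  case empty
  then show ?case by (auto simp: pair_coloring_def)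
next
  case (insert e E)
  obtain u v where e: "e = (u, v)" by (cases e)
  have fin1: "finite {y. (x, y) \<in> E}" for x
    by (rule finite_subset[of _ "snd ` E"]) (use insert.hyps(1) in force)+
  have fin2: "finite {x. (x, y) \<in> E}" for y
    by (rule finite_subset[of _ "fst ` E"]) (use insert.hyps(1) in force)+
  have "card {y. (x, y) \<in> E} \<le> card {y. (x, y) \<in> insert e E}" for x
    by (rule card_mono) (use fin1[of x] in \<open>auto simp: e Collect_disj_eq\<close>)
  then have row: "card {y. (x, y) \<in> E} \<le> k" for x
    using insert.prems(1) order_trans by blast
  have "card {x. (x, y) \<in> E} \<le> card {x. (x, y) \<in> insert e E}" for y
    by (rule card_mono) (use fin2[of y] in \<open>auto simp: e Collect_disj_eq\<close>)
  then have column: "card {x. (x, y) \<in> E} \<le> k" for y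
    using insert.prems(2) order_trans by blast
  obtain c where c: "pair_coloring k E c" using insert.IH row column by blast
  have "{y. (u, y) \<in> insert e E} = insert v {y. (u, y) \<in> E}"
    and "{x. (x, v) \<in> insert e E} = insert u {x. (x, v) \<in> E}" by (auto simp: e)
  then have "card {y. (u, y) \<in> E} < k" and "card {x. (x, v) \<in> E} < k"
    using insert.prems(1)[of u] insert.prems(2)[of v] insert.hyps(2) fin1 fin2 by (simp_all add: e)
  then obtain \<alpha> \<beta> where \<alpha>: "\<alpha> < k" "\<alpha> \<notin> (\<lambda>y. c (u, y)) ` {y. (u, y) \<in> E}"
    and \<beta>: "\<beta> < k" "\<beta> \<notin> (\<lambda>x. c (x, v)) ` {x. (x, v) \<in> E}"
    using missing_color fin1 fin2 by metis
  then obtain c' where c': "pair_coloring k E c'"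
    and u: "\<And>y. (u, y) \<in> E \<Longrightarrow> c' (u, y) \<noteq> \<alpha>" and v: "\<And>x. (x, v) \<in> E \<Longrightarrow> c' (x, v) \<noteq> \<alpha>"
    using kempe_swap[OF c, of u \<alpha> v \<beta>] by blast
  have "pair_coloring k (insert e E) (c'(e := \<alpha>))"
    using c' u v insert.hyps(2) \<alpha>(1) unfolding pair_coloring_def e
    by (intro conjI allI impI) (auto simp: image_subset_iff split: if_splits, blast+)
  then show ?case by blast
qed

section \<open>Optimal choices by moves and labels\<close>

lemma sum_card_swap:
  assumes "finite I" "finite J"
  shows "(\<Sum>j\<in>J. card {i \<in> I. P i j}) = (\<Sum>i\<in>I. card {j \<in> J. P i j})"
proof -
  have "(\<Sum>j\<in>J. card {i \<in> I. P i j}) = (\<Sum>j\<in>J. \<Sum>i\<in>I. of_bool (P i j))"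
    using assms by (simp add: Int_def)
  also have "\<dots> = (\<Sum>i\<in>I. \<Sum>j\<in>J. of_bool (P i j))" by (rule sum.swap)
  also have "\<dots> = (\<Sum>i\<in>I. card {j \<in> J. P i j})" using assms by (simp add: Int_def)
  finally show ?thesis .
qed

text \<open>
  An entry \<open>w i j\<close> is 0 outside the edge set, 1 for an unchosen edge and 2 for a chosen one.
\<close>

definition load :: "nat \<Rightarrow> (nat \<Rightarrow> nat \<Rightarrow> nat) \<Rightarrow> nat \<Rightarrow> nat" where
  "load n w j = card {i. i < n \<and> w i j = 2}"

text \<open>
  Only the first \<open>m\<close> entries of the row are inspected, so that the predicate can also describe
  a row of which only a part has been read.
\<close>

definition row_ok :: "nat \<Rightarrow> nat \<Rightarrow> (nat \<Rightarrow> bool) \<Rightarrow> (nat \<Rightarrow> nat) \<Rightarrow> bool" where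
  "row_ok m k a r \<longleftrightarrow> (\<forall>j<m. r j \<le> 2 \<and> (r j \<noteq> 0 \<longleftrightarrow> a j)) \<and>
     card {j. j < m \<and> r j = 2} \<le> k \<and> (card {j. j < m \<and> r j = 2} < k \<longrightarrow> (\<forall>j<m. r j \<noteq> 1))"

text \<open>
  Moving the choice from \<open>(i, j)\<close> to \<open>(i, j')\<close> is an arc from column \<open>j\<close> to column \<open>j'\<close> of a
  residual graph. The last two conditions make \<open>b j\<close> a lower bound for the length of a path from \<open>j\<close>
  to a column with spare capacity. As such a path has at most \<open>n - 1\<close> arcs, the label \<open>n + 1\<close> tells
  that none exists.
\<close>

definition valid :: "nat \<Rightarrow> nat \<Rightarrow> (nat \<Rightarrow> nat \<Rightarrow> bool) \<Rightarrow> (nat \<Rightarrow> nat \<Rightarrow> nat) \<Rightarrow> (nat \<Rightarrow> nat) \<Rightarrow> bool" where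
  "valid n k A w b \<longleftrightarrow>
     (\<forall>i<n. row_ok n k (A i) (w i)) \<and>
     (\<forall>j<n. b j \<le> n + 1) \<and>
     (\<forall>j<n. load n w j < k \<longrightarrow> b j = 0) \<and>
     (\<forall>i<n. \<forall>j<n. \<forall>j'<n. w i j = 2 \<and> w i j' = 1 \<longrightarrow> b j \<le> b j' + 1)"

definition move :: "nat \<Rightarrow> nat \<Rightarrow> nat \<Rightarrow> (nat \<Rightarrow> nat \<Rightarrow> nat) \<Rightarrow> nat \<Rightarrow> nat \<Rightarrow> nat" where
  "move i j j' w = w(i := (w i)(j := 1, j' := 2))"

text \<open>
  A move lowers the first summands, since the choice goes to a smaller label. Raising a label by one adds
  the load, at most \<open>n\<close>, which the second summand outweighs by its loss of \<open>n + 1\<close>.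
\<close>

definition potential :: "nat \<Rightarrow> (nat \<Rightarrow> nat \<Rightarrow> nat) \<Rightarrow> (nat \<Rightarrow> nat) \<Rightarrow> nat" where
  "potential n w b = (\<Sum>j<n. load n w j * b j + (n + 1) * (n + 1 - b j))"

lemma load_le: "load n w j \<le> n"
  unfolding load_def using card_mono[of "{..<n}" "{i. i < n \<and> w i j = 2}"] by auto

lemma load_cong: "(\<And>i. i < n \<Longrightarrow> w i j = w' i j) \<Longrightarrow> load n w j = load n w' j"
  unfolding load_def by (rule arg_cong[of _ _ card]) auto

lemma potential_cong:
  assumes "\<And>i j. i < n \<Longrightarrow> j < n \<Longrightarrow> w i j = w' i j" "\<And>j. j < n \<Longrightarrow> b j = b' j"
  shows "potential n w b = potential n w' b'"
  unfolding potential_def using load_cong[of n w _ w'] assms by (intro sum.cong) auto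

lemma relabel_valid:
  assumes v: "valid n k A w b" and j: "j < n" "k < load n w j" "b j \<le> n"
    and stuck: "\<And>i j'. \<lbrakk>i < n; j' < n; w i j = 2; w i j' = 1\<rbrakk> \<Longrightarrow> b j \<le> b j'"
  shows "valid n k A w (b(j := b j + 1))"
    and "potential n w (b(j := b j + 1)) < potential n w b"
proof -
  show "valid n k A w (b(j := b j + 1))"
    unfolding valid_def
  proof (intro conjI allI impI)
    fix i l l' assume l: "i < n" "l < n" "l' < n" "w i l = 2 \<and> w i l' = 1"
    then have old: "b l \<le> b l' + 1" using v unfolding valid_def by blast
    show "(b(j := b j + 1)) l \<le> (b(j := b j + 1)) l' + 1"
      using old stuck[OF l(1,3)] l(4) by auto
  next
    fix l assume "l < n" "load n w l < k"
    then show "(b(j := b j + 1)) l = 0" using v j(2) unfolding valid_def by auto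
  qed (use v j in \<open>auto simp: valid_def\<close>)
next
  have split: "potential n w b' = (load n w j * b' j + (n + 1) * (n + 1 - b' j)) +
      (\<Sum>l\<in>{..<n} - {j}. load n w l * b' l + (n + 1) * (n + 1 - b' l))" for b'
    unfolding potential_def using j(1) by (intro sum.remove) auto
  have "(\<Sum>l\<in>{..<n} - {j}. load n w l * (b(j := b j + 1)) l + (n + 1) * (n + 1 - (b(j := b j + 1)) l))
     = (\<Sum>l\<in>{..<n} - {j}. load n w l * b l + (n + 1) * (n + 1 - b l))"
    by (intro sum.cong) auto
  moreover obtain d where "n = b j + d" using j(3) le_Suc_ex by blast
  moreover have "load n w j * (b j + 1) + (n + 1) * d < load n w j * b j + (n + 1) * (d + 1)"
    using load_le[of n w j] by simp
  ultimately show "potential n w (b(j := b j + 1)) < potential n w b"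
    unfolding split by simp
qed

lemma move_valid:
  assumes v: "valid n k A w b" and j: "i < n" "j < n" "j' < n" "k < load n w j"
    and w: "w i j = 2" "w i j' = 1" "b j' < b j"
  shows "valid n k A (move i j j' w) b"
    and "potential n (move i j j' w) b < potential n w b"
proof -
  let ?w = "move i j j' w"
  have ne: "j \<noteq> j'" using w by auto
  have "{l. l < n \<and> w l j = 2} = insert i {l. l < n \<and> ?w l j = 2}"
    and "i \<notin> {l. l < n \<and> ?w l j = 2}"
    using w ne j by (auto simp: move_def)
  then have lj: "load n w j = load n ?w j + 1" unfolding load_def by simp
  have "{l. l < n \<and> ?w l j' = 2} = insert i {l. l < n \<and> w l j' = 2}"
    and "i \<notin> {l. l < n \<and> w l j' = 2}"
    using w ne j by (auto simp: move_def)
  then have lj': "load n ?w j' = load n w j' + 1" unfolding load_def by simp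
  have lo: "load n ?w l = load n w l" if "l \<noteq> j" "l \<noteq> j'" for l
    using that by (intro load_cong) (auto simp: move_def)
  have r: "row_ok n k (A i) (w i)" using v j unfolding valid_def by simp
  have "{l. l < n \<and> ?w i l = 2} = insert j' ({l. l < n \<and> w i l = 2} - {j})"
    using w ne j by (auto simp: move_def)
  moreover have "j' \<notin> {l. l < n \<and> w i l = 2} - {j}" "j \<in> {l. l < n \<and> w i l = 2}"
    using w j by auto
  ultimately have "card {l. l < n \<and> ?w i l = 2} = card {l. l < n \<and> w i l = 2}"
    by (simp add: card_Suc_Diff1 del: card_Diff_insert)
  moreover have "\<not> card {l. l < n \<and> w i l = 2} < k"
    using r j w unfolding row_ok_def by blast
  ultimately have "row_ok n k (A i) (?w i)"
    using r w j ne unfolding row_ok_def by (auto simp: move_def)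
  then have "\<forall>l<n. row_ok n k (A l) (?w l)"
    using v unfolding valid_def by (simp add: move_def)
  moreover have "\<forall>l<n. load n ?w l < k \<longrightarrow> b l = 0"
  proof (intro allI impI)
    fix l assume "l < n" "load n ?w l < k"
    then have "load n w l < k" using lj lj' lo[of l] j by (cases "l = j"; cases "l = j'") auto
    then show "b l = 0" using v \<open>l < n\<close> unfolding valid_def by blast
  qed
  moreover have "b l \<le> b l' + 1"
    if l: "a < n" "l < n" "l' < n" "?w a l = 2" "?w a l' = 1" for a l l'
  proof -
    have old: "w a l = 2 \<Longrightarrow> w a l' = 1 \<Longrightarrow> b l \<le> b l' + 1"
      and jl': "w i l' = 1 \<Longrightarrow> b j \<le> b l' + 1" and lj': "w i l = 2 \<Longrightarrow> b l \<le> b j' + 1"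
      using v l(1-3) j w unfolding valid_def by blast+
    show ?thesis using old jl' lj' l(4,5) w(3) unfolding move_def
      by (auto split: if_splits)
  qed
  moreover have "\<forall>l<n. b l \<le> n + 1" using v unfolding valid_def by blast
  ultimately show "valid n k A ?w b" unfolding valid_def by simp
  have remove: "sum f {..<n} = f j + (f j' + sum f ({..<n} - {j} - {j'}))" for f :: "nat \<Rightarrow> nat"
    using sum.remove[of "{..<n}" j f] sum.remove[of "{..<n} - {j}" j' f] j ne by simp
  have split: "potential n w' b = (load n w' j * b j + (n + 1) * (n + 1 - b j)) +
      ((load n w' j' * b j' + (n + 1) * (n + 1 - b j')) +
      (\<Sum>l\<in>{..<n} - {j} - {j'}. load n w' l * b l + (n + 1) * (n + 1 - b l)))" for w'
    unfolding potential_def by (rule remove)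
  have "(\<Sum>l\<in>{..<n} - {j} - {j'}. load n ?w l * b l + (n + 1) * (n + 1 - b l))
     = (\<Sum>l\<in>{..<n} - {j} - {j'}. load n w l * b l + (n + 1) * (n + 1 - b l))"
    using lo by (intro sum.cong) auto
  then show "potential n ?w b < potential n w b"
    unfolding split using lj lj' w(3) by simp
qed

text \<open>
  The \<open>n\<close> labels miss a value between 1 and \<open>n\<close> if one of them is \<open>n + 1\<close>. No arc of the residual graph
  descends by more than one, so none leads from above to below a missing value. If no
  label is \<open>n + 1\<close>, no column is overloaded and the empty cut will do.
\<close>

lemma cut_exists:
  assumes v: "valid n k A w b"
    and fin: "\<And>j. j < n \<Longrightarrow> load n w j \<le> k \<or> b j = n + 1"
  obtains S where "S \<subseteq> {..<n}" "\<And>j. j \<in> S \<Longrightarrow> k \<le> load n w j"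
    "\<And>j. j < n \<Longrightarrow> j \<notin> S \<Longrightarrow> load n w j \<le> k"
    "\<And>i j j'. \<lbrakk>i < n; j \<in> S; j' < n; j' \<notin> S; w i j = 2\<rbrakk> \<Longrightarrow> w i j' \<noteq> 1"
proof (cases "\<exists>j<n. b j = n + 1")
  case False
  then show ?thesis using fin that[of "{}"] by blast
next
  case True
  then obtain j0 where j0: "j0 < n" "b j0 = n + 1" by blast
  have "card (b ` ({..<n} - {j0})) \<le> n - 1"
    using card_image_le[of "{..<n} - {j0}" b] j0 by simp
  also have "n - 1 < card {1..n}" using j0 by simp
  finally have "\<not> {1..n} \<subseteq> b ` ({..<n} - {j0})"
    using card_mono[of "b ` ({..<n} - {j0})" "{1..n}"] by auto
  then obtain l where l: "1 \<le> l" "l \<le> n" "l \<notin> b ` ({..<n} - {j0})"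
    unfolding subset_iff atLeastAtMost_iff by blast
  then have gap: "b j \<noteq> l" if "j < n" for j using that j0 by (cases "j = j0") auto
  show ?thesis
  proof (rule that[of "{j. j < n \<and> l < b j}"])
    fix j assume "j \<in> {j. j < n \<and> l < b j}"
    then show "k \<le> load n w j" using v unfolding valid_def by force
  next
    fix j assume "j < n" "j \<notin> {j. j < n \<and> l < b j}"
    then show "load n w j \<le> k" using fin[of j] l by auto
  next
    fix i j j' assume a: "i < n" "j \<in> {j. j < n \<and> l < b j}" "j' < n" "j' \<notin> {j. j < n \<and> l < b j}" "w i j = 2"
    then have "b j' < l" "l < b j" "j < n" using gap[of j'] by auto
    then have "\<not> b j \<le> b j' + 1" by simp
    then show "w i j' \<noteq> 1" using a(1,3,5) v \<open>j < n\<close> unfolding valid_def by blast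
  qed auto
qed

text \<open>
  Inside the cut \<open>S\<close> each column counts \<open>k\<close>, the most it can hold. Outside, no competitor \<open>y\<close> has more
  entries than the choice, row by row: a row that chooses something inside \<open>S\<close> has chosen all its edges
  outside, and a row that does not has spent its whole allowance outside.
\<close>

lemma final_optimal:
  assumes v: "valid n k A w b"
    and fin: "\<And>j. j < n \<Longrightarrow> load n w j \<le> k \<or> b j = n + 1"
    and y: "\<And>i j. i < n \<Longrightarrow> j < n \<Longrightarrow> y i j \<Longrightarrow> A i j"
    and rows: "\<And>i. i < n \<Longrightarrow> card {j. j < n \<and> y i j} \<le> k"
    and columns: "\<And>j. j < n \<Longrightarrow> card {i. i < n \<and> y i j} \<le> k"
  shows "(\<Sum>j<n. card {i. i < n \<and> y i j}) \<le> (\<Sum>j<n. min (load n w j) k)"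
proof -
  obtain S where S: "S \<subseteq> {..<n}" "\<And>j. j \<in> S \<Longrightarrow> k \<le> load n w j"
    "\<And>j. j < n \<Longrightarrow> j \<notin> S \<Longrightarrow> load n w j \<le> k"
    "\<And>i j j'. \<lbrakk>i < n; j \<in> S; j' < n; j' \<notin> S; w i j = 2\<rbrakk> \<Longrightarrow> w i j' \<noteq> 1"
    by (rule cut_exists[OF v fin]) blast+
  let ?T = "{..<n} - S"
  have finS: "finite S" using S(1) finite_subset by blast
  have row: "card {j \<in> ?T. y i j} \<le> card {j \<in> ?T. w i j = 2}" if i: "i < n" for i
  proof (cases "\<exists>j\<in>S. w i j = 2")
    case True
    have r: "\<forall>j<n. w i j \<le> 2 \<and> (w i j \<noteq> 0 \<longleftrightarrow> A i j)" using v i by (simp add: valid_def row_ok_def)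
    have "w i j = 2" if "j < n" "j \<notin> S" "y i j" for j
    proof -
      have "w i j \<noteq> 1" using True S(4) i that by blast
      moreover have "w i j \<noteq> 0" "w i j \<le> 2" using r y[OF i] that by blast+
      ultimately show ?thesis by linarith
    qed
    then show ?thesis by (intro card_mono) auto
  next
    case False
    then have eq: "{j \<in> ?T. w i j = 2} = {j. j < n \<and> w i j = 2}" using S(1) by blast
    have sub: "card {j \<in> ?T. y i j} \<le> card {j. j < n \<and> y i j}" by (intro card_mono) auto
    show ?thesis
    proof (cases "card {j. j < n \<and> w i j = 2} < k")
      case True
      have r: "row_ok n k (A i) (w i)" using v i by (simp add: valid_def)
      have "w i j = 2" if "j < n" "y i j" for j
      proof -
        have "w i j \<noteq> 1" using True r that unfolding row_ok_def by blast
        moreover have "w i j \<noteq> 0" "w i j \<le> 2" using r y[OF i] that unfolding row_ok_def by blast+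
        ultimately show ?thesis by linarith
      qed
      then have "card {j. j < n \<and> y i j} \<le> card {j. j < n \<and> w i j = 2}" by (intro card_mono) auto
      then show ?thesis using eq sub by simp
    next
      case False
      then show ?thesis using eq sub rows[OF i] by simp
    qed
  qed
  have split: "(\<Sum>j<n. f j) = (\<Sum>j\<in>S. f j) + (\<Sum>j\<in>?T. f j)" for f :: "nat \<Rightarrow> nat"
    using S(1) by (simp add: sum.subset_diff[of S "{..<n}"] add.commute)
  have "(\<Sum>j\<in>S. card {i. i < n \<and> y i j}) \<le> (\<Sum>j\<in>S. min (load n w j) k)"
  proof (rule sum_mono)
    fix j assume "j \<in> S"
    then show "card {i. i < n \<and> y i j} \<le> min (load n w j) k"
      using S(1,2) columns by (simp add: min_absorb2 subset_iff)
  qed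
  moreover have "(\<Sum>j\<in>?T. card {i. i < n \<and> y i j}) \<le> (\<Sum>j\<in>?T. min (load n w j) k)"
  proof -
    have "(\<Sum>j\<in>?T. card {i. i < n \<and> y i j}) = (\<Sum>i<n. card {j \<in> ?T. y i j})"
      using sum_card_swap[of "{..<n}" ?T y] by simp
    also have "\<dots> \<le> (\<Sum>i<n. card {j \<in> ?T. w i j = 2})" using row by (intro sum_mono) auto
    also have "\<dots> = (\<Sum>j\<in>?T. load n w j)"
      using sum_card_swap[of "{..<n}" ?T "\<lambda>i j. w i j = 2"] by (simp add: load_def)
    also have "\<dots> = (\<Sum>j\<in>?T. min (load n w j) k)" using S(3) by (intro sum.cong) auto
    finally show ?thesis .
  qed
  ultimately show ?thesis unfolding split by simp
qed

section \<open>The double cover\<close>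

lemma finite_nu_set:
  assumes "simple_graph G"
  shows "finite {card (edges H) | H. subgraph H G \<and> edge_colorable k H}"
proof (rule finite_subset)
  have "finite (edges G)"
    using assms unfolding simple_graph_def by (meson PowI finite_Pow_iff finite_subset subsetI)
  then show "{card (edges H) | H. subgraph H G \<and> edge_colorable k H} \<subseteq> {..card (edges G)}"
    by (auto simp: subgraph_def intro: card_mono)
qed simp

lemma nu_ge:
  assumes "simple_graph G" "subgraph H G" "edge_colorable k H"
  shows "card (edges H) \<le> nu k G"
  unfolding nu_def by (rule Max_ge[OF finite_nu_set[OF assms(1)]]) (use assms(2,3) in blast)

lemma nu_attained:
  assumes "simple_graph G"
  obtains H where "subgraph H G" "edge_colorable k H" "nu k G = card (edges H)"
proof -
  have "subgraph (verts G, {}) G" "edge_colorable k (verts G, {})"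
    using assms by (auto simp: subgraph_def simple_graph_def edge_colorable_def)
  then have "{card (edges H) | H. subgraph H G \<and> edge_colorable k H} \<noteq> {}" by blast
  from Max_in[OF finite_nu_set[OF assms] this] show ?thesis
    using that unfolding nu_def by auto
qed

lemma colorable_degree:
  assumes "edge_colorable k H"
  shows "card {j. j < n \<and> {i, j} \<in> edges H} \<le> k"
proof -
  obtain c where c: "c ` edges H \<subseteq> {..<k}"
    "\<forall>e\<in>edges H. \<forall>f\<in>edges H. e \<noteq> f \<and> e \<inter> f \<noteq> {} \<longrightarrow> c e \<noteq> (c f :: nat)"
    using assms unfolding edge_colorable_def by blast
  have "inj_on (\<lambda>j. c {i, j}) {j. j < n \<and> {i, j} \<in> edges H}"
  proof (rule inj_onI)
    fix j j' assume "j \<in> {j. j < n \<and> {i, j} \<in> edges H}" "j' \<in> {j. j < n \<and> {i, j} \<in> edges H}"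
      and "c {i, j} = c {i, j'}"
    then have "\<not> ({i, j} \<noteq> {i, j'} \<and> {i, j} \<inter> {i, j'} \<noteq> {})"
      using c(2)[rule_format, of "{i, j}" "{i, j'}"] by auto
    then have "{i, j} = {i, j'}" by simp
    then show "j = j'" by (auto simp: doubleton_eq_iff)
  qed
  then have "card {j. j < n \<and> {i, j} \<in> edges H} \<le> card {..<k}"
    by (rule card_inj_on_le) (use c(1) in auto)
  then show ?thesis by simp
qed

lemma handshake:
  fixes E :: "nat set set"
  assumes H: "\<And>e. e \<in> E \<Longrightarrow> e \<subseteq> {..<n} \<and> card e = 2"
  shows "(\<Sum>j<n. card {i. i < n \<and> {i, j} \<in> E}) = 2 * card E"
proof -
  have fin: "finite E" by (rule finite_subset[of _ "Pow {..<n}"]) (use H in blast, simp)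
  have "card {i. i < n \<and> {i, j} \<in> E} = card {e \<in> E. j \<in> e}" if "j < n" for j
  proof (rule bij_betw_same_card)
    show "bij_betw (\<lambda>i. {i, j}) {i. i < n \<and> {i, j} \<in> E} {e \<in> E. j \<in> e}"
    proof (rule bij_betw_imageI)
      show "inj_on (\<lambda>i. {i, j}) {i. i < n \<and> {i, j} \<in> E}"
        by (auto simp: inj_on_def doubleton_eq_iff)
      have "e \<in> (\<lambda>i. {i, j}) ` {i. i < n \<and> {i, j} \<in> E}" if "e \<in> E" "j \<in> e" for e
      proof -
        obtain x y where "e = {x, y}" using H[OF \<open>e \<in> E\<close>] card_2_iff by metis
        then obtain i where "e = {i, j}" using \<open>j \<in> e\<close> by blast
        then show ?thesis using H[OF \<open>e \<in> E\<close>] \<open>e \<in> E\<close> by auto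
      qed
      then show "(\<lambda>i. {i, j}) ` {i. i < n \<and> {i, j} \<in> E} = {e \<in> E. j \<in> e}" by auto
    qed
  qed
  then have "(\<Sum>j<n. card {i. i < n \<and> {i, j} \<in> E}) = (\<Sum>j<n. card {e \<in> E. j \<in> e})" by simp
  also have "\<dots> = (\<Sum>e\<in>E. card {j \<in> {..<n}. j \<in> e})" using fin by (intro sum_card_swap) auto
  also have "\<dots> = (\<Sum>e\<in>E. 2)"
  proof (rule sum.cong)
    fix e assume "e \<in> E"
    then have "{j \<in> {..<n}. j \<in> e} = e" using H by auto
    then show "card {j \<in> {..<n}. j \<in> e} = 2" using H \<open>e \<in> E\<close> by simp
  qed simp
  finally show ?thesis by simp
qed

text \<open>
  This is where Koenig's theorem turns a degree bound into a lower bound for \<open>\<nu>\<^sub>k\<close>.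
\<close>

lemma nu_ge_pairs:
  assumes G: "simple_graph G" and E: "\<And>x y. (x, y) \<in> E \<Longrightarrow> {x, y} \<in> edges G \<and> x \<in> X \<and> y \<in> Y"
    and disj: "X \<inter> Y = {}"
    and deg: "\<And>x. card {y. (x, y) \<in> E} \<le> k" "\<And>y. card {x. (x, y) \<in> E} \<le> k"
  shows "card E \<le> nu k G"
proof -
  have sub: "{x, y} \<subseteq> verts G" if "(x, y) \<in> E" for x y
    using E[OF that] G unfolding simple_graph_def by blast
  have "finite E"
    by (rule finite_subset[of _ "verts G \<times> verts G"]) (use sub G in \<open>auto simp: simple_graph_def\<close>)
  then obtain c where c: "pair_coloring k E c" using koenig_edge_coloring deg by blast
  let ?f = "\<lambda>(x, y). {x, y}"
  have eq: "x = x' \<and> y = y'" if "(x, y) \<in> E" "(x', y') \<in> E" "{x, y} = {x', y'}" for x y x' y'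
    using E[OF that(1)] E[OF that(2)] that(3) disj by (auto simp: doubleton_eq_iff)
  then have inj: "inj_on ?f E" by (auto simp: inj_on_def)
  let ?c = "\<lambda>e. c (inv_into E ?f e)"
  have cf: "?c {x, y} = c (x, y)" if "(x, y) \<in> E" for x y
    using inv_into_f_f[OF inj that] by simp
  let ?H = "(verts G, ?f ` E)"
  have "?f ` E \<subseteq> edges G" using E by auto
  moreover from this have "\<forall>e\<in>edges ?H. e \<subseteq> verts G \<and> card e = 2"
    using G unfolding simple_graph_def snd_conv by blast
  ultimately have "subgraph ?H G" using G unfolding subgraph_def simple_graph_def by simp
  moreover have "edge_colorable k ?H"
    unfolding edge_colorable_def
  proof (intro exI[of _ ?c] conjI ballI impI)
    show "?c ` edges ?H \<subseteq> {..<k}" using c cf by (auto simp: pair_coloring_def)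
  next
    fix e f assume "e \<in> edges ?H" "f \<in> edges ?H" and ef: "e \<noteq> f \<and> e \<inter> f \<noteq> {}"
    then obtain x y x' y' where e: "(x, y) \<in> E" "e = {x, y}" and f: "(x', y') \<in> E" "f = {x', y'}"
      by auto
    have "x = x' \<or> y = y'" using ef E[OF e(1)] E[OF f(1)] disj unfolding e(2) f(2) by blast
    then show "?c e \<noteq> ?c f"
      using c e f ef unfolding pair_coloring_def by (metis cf)
  qed
  ultimately have "card (edges ?H) \<le> nu k G" using nu_ge[OF G] by blast
  then show ?thesis using card_image[OF inj] by simp
qed

text \<open>
  Deleting chosen entries from overloaded columns only lowers row sums.
\<close>

lemma trim_columns:
  assumes v: "valid n k A w b"
  obtains z where "\<And>i j. z i j \<Longrightarrow> i < n \<and> j < n \<and> A i j"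
    "\<And>i. card {j. z i j} \<le> k" "\<And>j. card {i. z i j} \<le> k"
    "card {(i, j). z i j} = (\<Sum>j<n. min (load n w j) k)"
proof -
  have "\<exists>Z. Z \<subseteq> {i. i < n \<and> w i j = 2} \<and> card Z = min (load n w j) k" for j
    by (rule obtain_subset_with_card_n[of "min (load n w j) k" "{i. i < n \<and> w i j = 2}"])
       (auto simp: load_def)
  then obtain Z where Z: "\<And>j. Z j \<subseteq> {i. i < n \<and> w i j = 2}" "\<And>j. card (Z j) = min (load n w j) k"
    by metis
  let ?z = "\<lambda>i j. j < n \<and> i \<in> Z j"
  show ?thesis
  proof (rule that[of ?z])
    fix i j assume z: "?z i j"
    then have "i < n" "w i j = 2" using Z(1) by auto
    moreover from this have "w i j \<noteq> 0 \<longleftrightarrow> A i j"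
      using z v unfolding valid_def row_ok_def by blast
    ultimately show "i < n \<and> j < n \<and> A i j" using z by simp
  next
    fix i show "card {j. ?z i j} \<le> k"
    proof (cases "i < n")
      case True
      have "card {j. ?z i j} \<le> card {j. j < n \<and> w i j = 2}" using Z(1) by (intro card_mono) auto
      also have "\<dots> \<le> k" using v True by (simp add: valid_def row_ok_def)
      finally show ?thesis .
    next
      case False
      then have "{j. ?z i j} = {}" using Z(1) by auto
      then show ?thesis by (simp only: card.empty le0)
    qed
  next
    fix j show "card {i. ?z i j} \<le> k" using Z(2)[of j] by (cases "j < n") auto
  next
    have finZ: "finite (Z j)" for j using Z(1)[of j] by (rule finite_subset) simp
    have "{(i, j). ?z i j} = prod.swap ` (SIGMA j:{..<n}. Z j)" by auto
    then have "card {(i, j). ?z i j} = card (SIGMA j:{..<n}. Z j)"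
      by (metis card_image inj_swap inj_on_subset subset_UNIV)
    then show "card {(i, j). ?z i j} = (\<Sum>j<n. min (load n w j) k)"
      using finZ Z(2) by simp
  qed
qed

text \<open>
  For \<open>\<le>\<close>, the trimmed matrix splits into the entries from \<open>X\<close> to \<open>Y\<close> and those from \<open>Y\<close> to \<open>X\<close>,
  and each part is a subgraph of \<open>G\<close> of maximum degree at most \<open>k\<close>. For \<open>\<ge>\<close>, an optimal subgraph
  contributes each of its edges twice to its adjacency matrix.
\<close>

lemma sum_min_load_eq_nu:
  assumes G: "simple_graph G" "bipartite G" "verts G = {..<n}"
    and v: "valid n k (\<lambda>i j. {i, j} \<in> edges G) w b"
    and fin: "\<And>j. j < n \<Longrightarrow> load n w j \<le> k \<or> b j = n + 1"
  shows "(\<Sum>j<n. min (load n w j) k) = 2 * nu k G"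
proof (rule antisym)
  obtain X Y where XY: "X \<union> Y = verts G" "X \<inter> Y = {}"
    "\<forall>e\<in>edges G. \<exists>x\<in>X. \<exists>y\<in>Y. e = {x, y}"
    using G(2) unfolding bipartite_def by blast
  obtain z where z: "\<And>i j. z i j \<Longrightarrow> i < n \<and> j < n \<and> {i, j} \<in> edges G"
    "\<And>i. card {j. z i j} \<le> k" "\<And>j. card {i. z i j} \<le> k"
    "card {(i, j). z i j} = (\<Sum>j<n. min (load n w j) k)"
    using trim_columns[OF v] by blast
  have fin_z: "finite {j. z i j}" "finite {i. z i j}" for i j
    using finite_subset[of "{j. z i j}" "{..<n}"] finite_subset[of "{i. z i j}" "{..<n}"] z(1) by auto
  have half: "card {(i, j). z i j \<and> i \<in> V \<and> j \<in> W} \<le> nu k G" if "V \<inter> W = {}" for V W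
  proof (rule nu_ge_pairs[OF G(1) _ that])
    fix i have "card {j. z i j \<and> i \<in> V \<and> j \<in> W} \<le> card {j. z i j}"
      using fin_z by (intro card_mono) auto
    then show "card {j. (i, j) \<in> {(i, j). z i j \<and> i \<in> V \<and> j \<in> W}} \<le> k"
      using z(2)[of i] by simp
  next
    fix j have "card {i. z i j \<and> i \<in> V \<and> j \<in> W} \<le> card {i. z i j}"
      using fin_z by (intro card_mono) auto
    then show "card {i. (i, j) \<in> {(i, j). z i j \<and> i \<in> V \<and> j \<in> W}} \<le> k"
      using z(3)[of j] by simp
  qed (use z(1) in auto)
  have "(i \<in> X \<and> j \<in> Y) \<or> (i \<in> Y \<and> j \<in> X)" if "z i j" for i j
    using bspec[OF XY(3), of "{i, j}"] z(1)[OF that] by (auto simp: doubleton_eq_iff)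
  then have "{(i, j). z i j} =
      {(i, j). z i j \<and> i \<in> X \<and> j \<in> Y} \<union> {(i, j). z i j \<and> i \<in> Y \<and> j \<in> X}" by auto
  then have "card {(i, j). z i j} =
      card ({(i, j). z i j \<and> i \<in> X \<and> j \<in> Y} \<union> {(i, j). z i j \<and> i \<in> Y \<and> j \<in> X})"
    by (rule arg_cong)
  also have "\<dots> \<le>
      card {(i, j). z i j \<and> i \<in> X \<and> j \<in> Y} + card {(i, j). z i j \<and> i \<in> Y \<and> j \<in> X}"
    by (rule card_Un_le)
  also have "\<dots> \<le> nu k G + nu k G" using XY(2) by (intro add_mono half) auto
  finally show "(\<Sum>j<n. min (load n w j) k) \<le> 2 * nu k G" using z(4) by simp
next
  obtain H where H: "subgraph H G" "edge_colorable k H" "nu k G = card (edges H)"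
    using nu_attained[OF G(1)] by blast
  have "2 * nu k G = (\<Sum>j<n. card {i. i < n \<and> {i, j} \<in> edges H})"
    unfolding H(3)
  proof (rule handshake[symmetric])
    fix e assume "e \<in> edges H"
    then show "e \<subseteq> {..<n} \<and> card e = 2"
      using H(1) G(3) unfolding subgraph_def simple_graph_def by auto
  qed
  also have "\<dots> \<le> (\<Sum>j<n. min (load n w j) k)"
  proof (rule final_optimal[OF v fin])
    fix j show "card {i. i < n \<and> {i, j} \<in> edges H} \<le> k"
      using colorable_degree[OF H(2), of n j] by (simp add: insert_commute)
  qed (use H colorable_degree[OF H(2)] in \<open>auto simp: subgraph_def\<close>)
  finally show "2 * nu k G \<le> (\<Sum>j<n. min (load n w j) k)" .
qed

section \<open>Structured programs with step counts\<close>

text \<open>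
  The only jump of the machine is conditional. Two constructs are compiled to a single jump
  each: \<open>IfZ r c\<close> runs \<open>c\<close> if register \<open>r\<close> is zero, and \<open>Rep c r\<close> runs \<open>c\<close> once and then again
  as long as \<open>r\<close> is positive afterwards.
\<close>

datatype com =
    Ins instr
  | Seq com com (infixr ";;" 60)
  | IfZ nat com
  | Rep com nat

fun clen :: "com \<Rightarrow> nat" where
  "clen (Ins i) = 1"
| "clen (c ;; d) = clen c + clen d"
| "clen (IfZ r c) = Suc (clen c)"
| "clen (Rep c r) = Suc (clen c)"

fun compile :: "nat \<Rightarrow> com \<Rightarrow> instr list" where
  "compile l (Ins i) = [i]"
| "compile l (c ;; d) = compile l c @ compile (l + clen c) d"
| "compile l (IfZ r c) = JumpPos r (Suc (l + clen c)) # compile (Suc l) c"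
| "compile l (Rep c r) = compile l c @ [JumpPos r l]"

lemma length_compile [simp]: "length (compile l c) = clen c"
  by (induction c arbitrary: l) auto

type_synonym state = "(nat \<Rightarrow> nat) \<times> nat list"

definition conf :: "nat \<Rightarrow> state \<Rightarrow> config" where
  "conf l s = \<lparr>pc = l, reg = fst s, inp = snd s\<rparr>"

inductive run :: "instr list \<Rightarrow> nat \<Rightarrow> config \<Rightarrow> config \<Rightarrow> bool" for P where
  run_0: "run P 0 c c"
| run_Suc: "pc c < length P \<Longrightarrow> run P m (step (P ! pc c) c) c' \<Longrightarrow> run P (Suc m) c c'"

lemma run_trans: "run P m c c' \<Longrightarrow> run P m' c' c'' \<Longrightarrow> run P (m + m') c c''"
  by (induction rule: run.induct) (auto intro: run.intros)

text \<open>
  Jump targets are absolute, hence the quantification over the surrounding code.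
\<close>

definition exec :: "com \<Rightarrow> nat \<Rightarrow> state \<Rightarrow> state \<Rightarrow> bool" where
  "exec c m s s' \<longleftrightarrow> (\<forall>P pre post. P = pre @ compile (length pre) c @ post \<longrightarrow>
     run P m (conf (length pre) s) (conf (length pre + clen c) s'))"

text \<open>
  Total correctness with a bound on the number of steps.
\<close>

definition triple :: "(state \<Rightarrow> bool) \<Rightarrow> com \<Rightarrow> nat \<Rightarrow> (state \<Rightarrow> bool) \<Rightarrow> bool" where
  "triple P c N Q \<longleftrightarrow> (\<forall>s. P s \<longrightarrow> (\<exists>m s'. m \<le> N \<and> exec c m s s' \<and> Q s'))"

fun no_jump :: "instr \<Rightarrow> bool" where
  "no_jump (JumpPos _ _) = False"
| "no_jump _ = True"

definition effect :: "instr \<Rightarrow> state \<Rightarrow> state" where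
  "effect i s = (let c = step i (conf 0 s) in (reg c, inp c))"

lemma effect_simps [simp]:
  "effect (SetConst i a) (r, xs) = (r(i := a), xs)"
  "effect (Add i j k) (r, xs) = (r(i := r j + r k), xs)"
  "effect (Sub i j k) (r, xs) = (r(i := r j - r k), xs)"
  "effect (Load i j) (r, xs) = (r(i := r (r j)), xs)"
  "effect (Store i j) (r, xs) = (r(r i := r j), xs)"
  "effect (Read i) (r, []) = (r(i := 0), [])"
  "effect (Read i) (r, x # xs) = (r(i := x), xs)"
  by (simp_all add: effect_def conf_def)

lemma step_effect: "no_jump i \<Longrightarrow> step i (conf l s) = conf (Suc l) (effect i s)"
  by (cases s; cases i) (auto simp: effect_def conf_def split: list.splits)

lemma exec_Ins: "no_jump i \<Longrightarrow> exec (Ins i) 1 s (effect i s)"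
  unfolding exec_def
proof (intro allI impI)
  fix P pre post assume i: "no_jump i" and P: "P = pre @ compile (length pre) (Ins i) @ post"
  show "run P 1 (conf (length pre) s) (conf (length pre + clen (Ins i)) (effect i s))"
    using run.run_Suc[OF _ run.run_0, of "conf (length pre) s" P] i P step_effect[OF i, of "length pre" s]
    by (simp add: conf_def)
qed

lemma exec_Seq:
  assumes "exec c m s s'" "exec d m' s' s''"
  shows "exec (c ;; d) (m + m') s s''"
  unfolding exec_def
proof (intro allI impI)
  fix P pre post assume P: "P = pre @ compile (length pre) (c ;; d) @ post"
  have "run P m (conf (length pre) s) (conf (length pre + clen c) s')"
    using assms(1) P unfolding exec_def by simp
  moreover have "run P m' (conf (length (pre @ compile (length pre) c)) s')
      (conf (length (pre @ compile (length pre) c) + clen d) s'')"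
    using assms(2) P unfolding exec_def
    by (intro assms(2)[unfolded exec_def, rule_format, of _ _ post]) simp
  ultimately show "run P (m + m') (conf (length pre) s) (conf (length pre + clen (c ;; d)) s'')"
    using run_trans by (fastforce simp: add.assoc)
qed

lemma exec_IfZ_skip:
  assumes "fst s r > 0"
  shows "exec (IfZ r c) 1 s s"
  unfolding exec_def
proof (intro allI impI)
  fix P pre post assume P: "P = pre @ compile (length pre) (IfZ r c) @ post"
  show "run P 1 (conf (length pre) s) (conf (length pre + clen (IfZ r c)) s)"
    using run.run_Suc[OF _ run.run_0, of "conf (length pre) s" P] P assms by (simp add: conf_def)
qed

lemma exec_IfZ:
  assumes "fst s r = 0" "exec c m s s'"
  shows "exec (IfZ r c) (Suc m) s s'"
  unfolding exec_def
proof (intro allI impI)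
  fix P pre post assume P: "P = pre @ compile (length pre) (IfZ r c) @ post"
  let ?j = "JumpPos r (Suc (length pre + clen c))"
  have "run P m (conf (length (pre @ [?j])) s) (conf (length (pre @ [?j]) + clen c) s')"
    by (intro assms(2)[unfolded exec_def, rule_format, of _ _ post]) (simp add: P)
  then show "run P (Suc m) (conf (length pre) s) (conf (length pre + clen (IfZ r c)) s')"
    by (intro run.run_Suc) (use P assms(1) in \<open>simp_all add: conf_def\<close>)
qed

lemma exec_Rep_stop:
  assumes "exec c m s s'" "fst s' r = 0"
  shows "exec (Rep c r) (m + 1) s s'"
  unfolding exec_def
proof (intro allI impI)
  fix P pre post assume P: "P = pre @ compile (length pre) (Rep c r) @ post"
  have "run P m (conf (length pre) s) (conf (length pre + clen c) s')"
    by (intro assms(1)[unfolded exec_def, rule_format, of _ _ "JumpPos r (length pre) # post"]) (simp add: P)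
  moreover have "run P 1 (conf (length pre + clen c) s') (conf (length pre + clen (Rep c r)) s')"
    using run.run_Suc[OF _ run.run_0, of "conf (length pre + clen c) s'" P] P assms(2)
    by (simp add: conf_def nth_append)
  ultimately show "run P (m + 1) (conf (length pre) s) (conf (length pre + clen (Rep c r)) s')"
    by (rule run_trans)
qed

lemma exec_Rep_again:
  assumes "exec c m s s'" "fst s' r > 0" "exec (Rep c r) m' s' s''"
  shows "exec (Rep c r) (m + 1 + m') s s''"
  unfolding exec_def
proof (intro allI impI)
  fix P pre post assume P: "P = pre @ compile (length pre) (Rep c r) @ post"
  have "run P m (conf (length pre) s) (conf (length pre + clen c) s')"
    by (intro assms(1)[unfolded exec_def, rule_format, of _ _ "JumpPos r (length pre) # post"]) (simp add: P)
  moreover have "run P 1 (conf (length pre + clen c) s') (conf (length pre) s')"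
    using run.run_Suc[OF _ run.run_0, of "conf (length pre + clen c) s'" P] P assms(2)
    by (simp add: conf_def nth_append)
  moreover have "run P m' (conf (length pre) s') (conf (length pre + clen (Rep c r)) s'')"
    by (intro assms(3)[unfolded exec_def, rule_format, of _ _ post]) (simp add: P)
  ultimately show "run P (m + 1 + m') (conf (length pre) s) (conf (length pre + clen (Rep c r)) s'')"
    by (blast intro: run_trans)
qed

fun loop_free :: "com \<Rightarrow> bool" where
  "loop_free (Ins i) \<longleftrightarrow> no_jump i"
| "loop_free (c ;; d) \<longleftrightarrow> loop_free c \<and> loop_free d"
| "loop_free (IfZ r c) \<longleftrightarrow> loop_free c"
| "loop_free (Rep c r) \<longleftrightarrow> False"

text \<open>
  For loop-free code, verification is evaluation by the simplifier. On loops the value is arbitrary.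
\<close>

fun sem :: "com \<Rightarrow> state \<Rightarrow> state" where
  "sem (Ins i) s = effect i s"
| "sem (c ;; d) s = sem d (sem c s)"
| "sem (IfZ r c) s = (if fst s r = 0 then sem c s else s)"
| "sem (Rep c r) s = s"

lemma exec_loop_free: "loop_free c \<Longrightarrow> \<exists>m \<le> clen c. exec c m s (sem c s)"
proof (induction c arbitrary: s)
  case (Ins i)
  then show ?case using exec_Ins[of i s] by (intro exI[of _ 1]) simp
next
  case (Seq c d)
  then have "\<exists>m\<le>clen c. exec c m s (sem c s)"
    and "\<exists>m\<le>clen d. exec d m (sem c s) (sem d (sem c s))" by simp_all
  then obtain m m' where "m \<le> clen c" "exec c m s (sem c s)"
    "m' \<le> clen d" "exec d m' (sem c s) (sem d (sem c s))" by blast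
  then show ?case using exec_Seq[of c m s "sem c s" d m' "sem d (sem c s)"]
    by (intro exI[of _ "m + m'"]) simp
next
  case (IfZ r c)
  then have "\<exists>m\<le>clen c. exec c m s (sem c s)" by simp
  then obtain m where m: "m \<le> clen c" "exec c m s (sem c s)" by blast
  show ?case
  proof (cases "fst s r = 0")
    case True
    then show ?thesis using exec_IfZ[OF True m(2)] m(1) by (intro exI[of _ "Suc m"]) simp
  next
    case False
    then show ?thesis using exec_IfZ_skip[of s r c] by (intro exI[of _ 1]) simp
  qed
qed simp

lemma triple_loop_free:
  assumes "loop_free c" "\<And>r xs. P (r, xs) \<Longrightarrow> Q (sem c (r, xs))"
  shows "triple P c (clen c) Q"
  unfolding triple_def using exec_loop_free[OF assms(1)] assms(2) by (metis surj_pair)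

lemma triple_conseq:
  assumes "triple P c N Q" "\<And>r xs. P' (r, xs) \<Longrightarrow> P (r, xs)" "\<And>r xs. Q (r, xs) \<Longrightarrow> Q' (r, xs)" "N \<le> N'"
  shows "triple P' c N' Q'"
  unfolding triple_def
proof (intro allI impI)
  fix s assume "P' s"
  then have "P s" using assms(2) by (metis surj_pair)
  then obtain m s' where "m \<le> N" "exec c m s s'" "Q s'" using assms(1) unfolding triple_def by blast
  then show "\<exists>m s'. m \<le> N' \<and> exec c m s s' \<and> Q' s'"
    using assms(3,4) by (metis surj_pair order_trans)
qed

lemma triple_Seq:
  assumes "triple P c N Q" "triple Q d M R"
  shows "triple P (c ;; d) (N + M) R"
  unfolding triple_def
proof (intro allI impI)
  fix s assume "P s"
  then obtain m s' where 1: "m \<le> N" "exec c m s s'" "Q s'" using assms(1) unfolding triple_def by blast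
  then obtain m' s'' where "m' \<le> M" "exec d m' s' s''" "R s''" using assms(2) unfolding triple_def by blast
  then show "\<exists>m s'. m \<le> N + M \<and> exec (c ;; d) m s s' \<and> R s'"
    using 1 exec_Seq by (intro exI[of _ "m + m'"] exI[of _ s'']) auto
qed

lemma triple_IfZ:
  assumes "triple (\<lambda>s. P s \<and> fst s r = 0) c N Q" "\<And>s xs. P (s, xs) \<Longrightarrow> s r > 0 \<Longrightarrow> Q (s, xs)"
  shows "triple P (IfZ r c) (N + 1) Q"
  unfolding triple_def
proof (intro allI impI)
  fix s assume "P s"
  show "\<exists>m s'. m \<le> N + 1 \<and> exec (IfZ r c) m s s' \<and> Q s'"
  proof (cases "fst s r = 0")
    case True
    then obtain m s' where "m \<le> N" "exec c m s s'" "Q s'"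
      using assms(1) \<open>P s\<close> unfolding triple_def by blast
    then show ?thesis using exec_IfZ[of s, OF True] by (intro exI[of _ "Suc m"] exI[of _ s']) auto
  next
    case False
    then have "Q s" using assms(2)[of "fst s" "snd s"] \<open>P s\<close> by simp
    then show ?thesis using exec_IfZ_skip[of s r c] False by (intro exI[of _ 1] exI[of _ s]) auto
  qed
qed

text \<open>
  The variant \<open>f\<close> proves termination and also bounds the number of rounds.
\<close>

lemma triple_Rep:
  assumes "\<And>a. triple (\<lambda>s. P s \<and> f s = a) c N (\<lambda>s. if fst s r = 0 then Q s else P s \<and> f s < (a::nat))"
  shows "triple (\<lambda>s. P s \<and> f s \<le> a) (Rep c r) ((a + 1) * (N + 1)) Q"
proof -
  have "\<exists>m s'. m \<le> (f s + 1) * (N + 1) \<and> exec (Rep c r) m s s' \<and> Q s'" if "P s" for s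
    using that
  proof (induction "f s" arbitrary: s rule: less_induct)
    case less
    then obtain m s' where m: "m \<le> N" "exec c m s s'" and
      s': "if fst s' r = 0 then Q s' else P s' \<and> f s' < f s"
      using assms[of "f s"] unfolding triple_def by blast
    show ?case
    proof (cases "fst s' r = 0")
      case True
      then have "exec (Rep c r) (m + 1) s s'" "Q s'" using exec_Rep_stop[OF m(2)] s' by auto
      moreover have "m + 1 \<le> (f s + 1) * (N + 1)" using m(1) by simp
      ultimately show ?thesis by blast
    next
      case False
      then have "P s'" and lt: "f s' < f s" using s' by auto
      then obtain m' s'' where m': "m' \<le> (f s' + 1) * (N + 1)" "exec (Rep c r) m' s' s''" "Q s''"
        using less.hyps by blast
      then have "exec (Rep c r) (m + 1 + m') s s''" using exec_Rep_again[OF m(2)] False by simp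
      moreover have "m + 1 + m' \<le> (f s + 1) * (N + 1)"
      proof -
        have "(f s' + 1) * (N + 1) + (N + 1) \<le> (f s + 1) * (N + 1)"
          using mult_le_mono1[of "f s' + 2" "f s + 1" "N + 1"] lt by simp
        then show ?thesis using m(1) m'(1) by linarith
      qed
      ultimately show ?thesis using m'(3) by blast
    qed
  qed
  moreover have "(f s + 1) * (N + 1) \<le> (a + 1) * (N + 1)" if "f s \<le> a" for s
    using that by (intro mult_le_mono1) simp
  ultimately show ?thesis unfolding triple_def by (meson order_trans)
qed

text \<open>
  Register 1 serves as scratch space of the derived loops: here it is zero exactly if the loop is entered.
\<close>

definition While :: "nat \<Rightarrow> com \<Rightarrow> com" where
  "While r c = (Ins (SetConst 1 1) ;; Ins (Sub 1 1 r)) ;; IfZ 1 (Rep c r)"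

text \<open>
  Register \<open>v\<close> counts upwards to the content of \<open>b\<close>, and \<open>t\<close> holds the number of remaining rounds.
\<close>

definition For :: "nat \<Rightarrow> nat \<Rightarrow> nat \<Rightarrow> com \<Rightarrow> com" where
  "For v t b c = (Ins (SetConst v 0) ;; Ins (Sub t b v)) ;;
     While t (c ;; Ins (SetConst 1 1) ;; Ins (Add v v 1) ;; Ins (Sub t b v))"

lemma triple_While:
  assumes body: "\<And>a. triple (\<lambda>s. P s \<and> f s = a \<and> fst s r > 0) c N (\<lambda>s. P s \<and> f s < (a::nat))"
    and stable: "\<And>s xs x. P (s, xs) \<Longrightarrow> P (s(1 := x), xs) \<and> f (s(1 := x), xs) = f (s, xs)"
    and "r \<noteq> 1"
  shows "triple (\<lambda>s. P s \<and> f s \<le> a) (While r c) ((a + 1) * (N + 1) + 3) (\<lambda>s. P s \<and> fst s r = 0)"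
proof -
  have "triple (\<lambda>s. P s \<and> f s \<le> a) (Ins (SetConst 1 1) ;; Ins (Sub 1 1 r))
          (clen (Ins (SetConst 1 1) ;; Ins (Sub 1 1 r)))
          (\<lambda>s. (P s \<and> f s \<le> a) \<and> (fst s 1 = 0 \<longleftrightarrow> fst s r > 0))"
    by (rule triple_loop_free) (use stable assms(3) in auto)
  moreover have "triple (\<lambda>s. (P s \<and> f s \<le> a) \<and> (fst s 1 = 0 \<longleftrightarrow> fst s r > 0)) (IfZ 1 (Rep c r))
     ((a + 1) * (N + 1) + 1) (\<lambda>s. P s \<and> fst s r = 0)"
  proof (rule triple_IfZ)
    have "triple (\<lambda>s. (P s \<and> fst s r > 0) \<and> f s \<le> a) (Rep c r) ((a + 1) * (N + 1)) (\<lambda>s. P s \<and> fst s r = 0)"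
      by (rule triple_Rep, rule triple_conseq[OF body]) auto
    then show "triple (\<lambda>s. ((P s \<and> f s \<le> a) \<and> (fst s 1 = 0 \<longleftrightarrow> fst s r > 0)) \<and> fst s 1 = 0) (Rep c r)
      ((a + 1) * (N + 1)) (\<lambda>s. P s \<and> fst s r = 0)"
      by (rule triple_conseq) auto
  qed auto
  ultimately have "triple (\<lambda>s. P s \<and> f s \<le> a) (While r c)
      (clen (Ins (SetConst 1 1) ;; Ins (Sub 1 1 r)) + ((a + 1) * (N + 1) + 1)) (\<lambda>s. P s \<and> fst s r = 0)"
    unfolding While_def by (rule triple_Seq)
  then show ?thesis by (rule triple_conseq) auto
qed

lemma triple_For:
  assumes body: "\<And>i. i < m \<Longrightarrow>
      triple (\<lambda>s. I i s \<and> fst s v = i) c N (\<lambda>s. I (Suc i) s \<and> fst s v = i)"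
    and stable: "\<And>i s xs x y z. I i (s, xs) \<Longrightarrow> I i (s(v := x, t := y, 1 := z), xs)"
    and bound: "\<And>i s xs. I i (s, xs) \<Longrightarrow> s b = m"
    and neq: "v \<noteq> 1" "t \<noteq> 1" "v \<noteq> t" "b \<noteq> v" "b \<noteq> t" "b \<noteq> 1"
  shows "triple (I 0) (For v t b c) ((m + 1) * (N + 4) + 5) (I m)"
proof -
  let ?P = "\<lambda>s. I (fst s v) s \<and> fst s v \<le> m \<and> fst s t = m - fst s v"
  let ?f = "\<lambda>s :: state. fst s t"
  let ?c = "c ;; Ins (SetConst 1 1) ;; Ins (Add v v 1) ;; Ins (Sub t b v)"
  have st1: "I i (s(1 := x), xs)" if "I i (s, xs)" for i s xs x
    using stable[OF that, of "s v" "s t" x] by simp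
  have body': "triple (\<lambda>s. ?P s \<and> ?f s = a \<and> fst s t > 0) ?c (N + 3) (\<lambda>s. ?P s \<and> ?f s < a)" for a
  proof (cases "0 < a \<and> a \<le> m")
    case True
    then have lt: "m - a < m" by auto
    let ?t = "Ins (SetConst 1 1) ;; Ins (Add v v 1) ;; Ins (Sub t b v)"
    have "triple (\<lambda>s. I (Suc (m - a)) s \<and> fst s v = m - a) ?t (clen ?t) (\<lambda>s. ?P s \<and> ?f s < a)"
    proof (rule triple_loop_free)
      fix r xs assume I: "I (Suc (m - a)) (r, xs) \<and> fst (r, xs) v = m - a"
      then have "r b = m" using bound by blast
      then show "?P (sem ?t (r, xs)) \<and> ?f (sem ?t (r, xs)) < a"
        using I stable[of "Suc (m - a)" r xs "Suc (m - a)" "m - Suc (m - a)" 1] neq True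
        by (auto simp: fun_upd_twist)
    qed simp
    from triple_Seq[OF body[OF lt] this] show ?thesis
      by (rule triple_conseq) (use True in \<open>auto simp: Suc_diff_le\<close>)
  next
    case False
    then show ?thesis unfolding triple_def by auto
  qed
  have loop: "triple (\<lambda>s. ?P s \<and> ?f s \<le> m) (While t ?c) ((m + 1) * (N + 3 + 1) + 3) (\<lambda>s. ?P s \<and> fst s t = 0)"
    by (rule triple_While[OF body']) (use st1 neq in auto)
  have start: "triple (I 0) (Ins (SetConst v 0) ;; Ins (Sub t b v))
     (clen (Ins (SetConst v 0) ;; Ins (Sub t b v))) (\<lambda>s. ?P s \<and> ?f s \<le> m)"
  proof (rule triple_loop_free)
    fix r xs assume I: "I 0 (r, xs)"
    have "I 0 (r(v := 0, t := m, 1 := (r(v := 0, t := m)) 1), xs)" by (rule stable[OF I])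
    then have "I 0 (r(v := 0, t := m), xs)" unfolding fun_upd_triv .
    then show "?P (sem (Ins (SetConst v 0) ;; Ins (Sub t b v)) (r, xs)) \<and>
        ?f (sem (Ins (SetConst v 0) ;; Ins (Sub t b v)) (r, xs)) \<le> m"
      using bound[OF I] neq by simp
  qed simp
  have "triple (I 0) (For v t b c)
      (clen (Ins (SetConst v 0) ;; Ins (Sub t b v)) + ((m + 1) * (N + 3 + 1) + 3))
      (\<lambda>s. ?P s \<and> fst s t = 0)"
    unfolding For_def by (rule triple_Seq[OF start loop])
  then show ?thesis by (rule triple_conseq) auto
qed


section \<open>From steps to logarithmic cost\<close>

lemma bit_length_le: "x < 2 ^ e \<Longrightarrow> 1 \<le> e \<Longrightarrow> bit_length x \<le> e"
  unfolding bit_length_def using floorlog_leI[of x 2 e] by simp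

lemma less_two_power_bit_length: "x < 2 ^ bit_length x"
  using floorlog_leD[of 2 x "bit_length x"] by (simp add: bit_length_def)

definition bounded :: "nat \<Rightarrow> config \<Rightarrow> bool" where
  "bounded e c \<longleftrightarrow> (\<forall>i. reg c i < 2 ^ e) \<and> (\<forall>x\<in>set (inp c). x < 2 ^ e)"

fun literal :: "instr \<Rightarrow> nat" where
  "literal (SetConst i a) = a"
| "literal _ = 0"

text \<open>
  Addition is the only instruction that produces new large numbers, and it adds at most one bit.
\<close>

lemma step_bounded:
  assumes "bounded e c" "literal i < 2 ^ e"
  shows "bounded (Suc e) (step i c)"
proof -
  have r: "reg c j < 2 ^ Suc e" and r2: "reg c j + reg c l < 2 ^ Suc e" for j l
    using assms(1) add_strict_mono[of "reg c j" "2 ^ e" "reg c l" "2 ^ e"]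
    unfolding bounded_def by (auto intro: less_le_trans)
  have x: "x < 2 ^ Suc e" if "x \<in> set (inp c)" for x
    using assms(1) that unfolding bounded_def by (auto intro: less_le_trans)
  have a: "literal i < 2 ^ Suc e" using assms(2) by simp
  show ?thesis
    using r r2 x a by (cases i) (auto simp: bounded_def less_imp_diff_less simp del: power_Suc split: list.splits)
qed

lemma cost_bounded:
  assumes "bounded e c" "1 \<le> e"
  shows "cost i c \<le> 2 * e"
proof -
  have r: "bit_length (reg c j) \<le> e" for j
    using assms bit_length_le unfolding bounded_def by blast
  have x: "bit_length x \<le> e" if "x \<in> set (inp c)" for x
    using assms that bit_length_le unfolding bounded_def by blast
  have r2: "bit_length (reg c j) + bit_length (reg c l) \<le> 2 * e" for j l
    using r[of j] r[of l] by linarith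
  have "bit_length (reg c j) \<le> 2 * e" for j using r[of j] by linarith
  then show ?thesis
    using r2 x assms(2) by (cases i) (fastforce split: list.splits)+
qed

lemma run_halts:
  assumes "run P m c c'" "length P \<le> pc c'" "bounded e c" "1 \<le> e" "\<forall>i\<in>set P. literal i < 2 ^ e"
  shows "\<exists>t \<le> m * (2 * (e + m)). halts_in P c t c'"
  using assms
proof (induction arbitrary: e rule: run.induct)
  case (run_0 c)
  then show ?case using halts_in.halt by auto
next
  case (run_Suc c m c')
  let ?i = "P ! pc c"
  have "?i \<in> set P" using run_Suc.hyps by simp
  then have "bounded (Suc e) (step ?i c)" using run_Suc.prems step_bounded by blast
  moreover have "\<forall>i\<in>set P. literal i < 2 ^ Suc e" using run_Suc.prems by fastforce
  ultimately obtain t where t: "t \<le> m * (2 * (Suc e + m))" "halts_in P (step ?i c) t c'"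
    using run_Suc.IH[of "Suc e"] run_Suc.prems(1) by auto
  have "cost ?i c \<le> 2 * e" using cost_bounded run_Suc.prems by blast
  then have "cost ?i c + t \<le> Suc m * (2 * (e + Suc m))" using t(1) by (simp add: algebra_simps)
  then show ?case using halts_in.step run_Suc.hyps(1) t(2) by blast
qed

definition poly_bounded :: "(nat \<Rightarrow> nat) \<Rightarrow> bool" where
  "poly_bounded f \<longleftrightarrow> (\<exists>p. \<forall>n. f n \<le> poly p n)"

lemma poly_bounded_const: "poly_bounded (\<lambda>_. a)"
  unfolding poly_bounded_def by (rule exI[of _ "[:a:]"]) simp

lemma poly_bounded_id: "poly_bounded (\<lambda>n. n)"
  unfolding poly_bounded_def by (rule exI[of _ "[:0, 1:]"]) simp

lemma poly_bounded_add:
  assumes "poly_bounded f" "poly_bounded g"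
  shows "poly_bounded (\<lambda>n. f n + g n)"
proof -
  obtain p q where "\<And>n. f n \<le> poly p n" "\<And>n. g n \<le> poly q n"
    using assms unfolding poly_bounded_def by blast
  then have "f n + g n \<le> poly (p + q) n" for n by (simp add: add_mono)
  then show ?thesis unfolding poly_bounded_def by blast
qed

lemma poly_bounded_mult:
  assumes "poly_bounded f" "poly_bounded g"
  shows "poly_bounded (\<lambda>n. f n * g n)"
proof -
  obtain p q where "\<And>n. f n \<le> poly p n" "\<And>n. g n \<le> poly q n"
    using assms unfolding poly_bounded_def by blast
  then have "f n * g n \<le> poly (p * q) n" for n by (simp add: mult_le_mono)
  then show ?thesis unfolding poly_bounded_def by blast
qed

lemmas poly_bounded_intros = poly_bounded_const poly_bounded_id poly_bounded_add poly_bounded_mult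

lemma poly_mono_nat: "x \<le> y \<Longrightarrow> poly p x \<le> poly p (y :: nat)"
  by (induction p) (auto simp: mult_le_mono add_mono)

text \<open>
  A polynomial bound on the number of steps yields one on the logarithmic cost, without
  any invariant about the sizes of the numbers that occur.
\<close>

lemma poly_time_solvableI:
  assumes triple: "\<And>x. x \<in> I \<Longrightarrow> triple (\<lambda>s. s = (\<lambda>_. 0, enc x)) c (T (sz x)) (\<lambda>s. fst s 0 = f x)"
    and sz: "\<And>x. x \<in> I \<Longrightarrow> sz x \<le> input_size (enc x)"
    and T: "poly_bounded T"
  shows "poly_time_solvable I enc f"
proof -
  let ?P = "compile 0 c"
  obtain p where p: "\<And>n. T n \<le> poly p n" using T unfolding poly_bounded_def by blast
  define K where "K = 1 + sum_list (map literal ?P)"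
  let ?q = "[:2:] * p * ([:K, 1:] + p)"
  show ?thesis
    unfolding poly_time_solvable_def
  proof (rule exI[of _ ?P], rule exI[of _ ?q], rule ballI)
    fix x assume x: "x \<in> I"
    let ?S = "input_size (enc x)"
    obtain m s where m: "m \<le> T (sz x)" "exec c m (\<lambda>_. 0, enc x) s" "fst s 0 = f x"
      using triple[OF x] unfolding triple_def by blast
    have "run ?P m (init_config (enc x)) (conf (length ?P) s)"
      using m(2)[unfolded exec_def, rule_format, of ?P "[]" "[]"]
      by (simp add: init_config_def conf_def)
    moreover have "bounded (?S + K) (init_config (enc x))"
    proof -
      have "y < 2 ^ (?S + K)" if "y \<in> set (enc x)" for y
      proof -
        have "bit_length y \<le> ?S"
          using that unfolding input_size_def by (simp add: member_le_sum_list)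
        then have "(2::nat) ^ bit_length y \<le> 2 ^ (?S + K)" by (intro power_increasing) auto
        then show ?thesis using less_two_power_bit_length[of y] by linarith
      qed
      then show ?thesis by (simp add: bounded_def init_config_def)
    qed
    moreover have "\<forall>i\<in>set ?P. literal i < 2 ^ (?S + K)"
    proof
      fix i assume "i \<in> set ?P"
      then have "literal i \<le> ?S + K" unfolding K_def by (simp add: member_le_sum_list trans_le_add2 le_SucI)
      then show "literal i < 2 ^ (?S + K)" using less_exp[of "?S + K"] by linarith
    qed
    ultimately obtain t where t: "t \<le> m * (2 * (?S + K + m))"
      "halts_in ?P (init_config (enc x)) t (conf (length ?P) s)"
      using run_halts[of ?P m "init_config (enc x)" "conf (length ?P) s" "?S + K"]
      by (auto simp: K_def conf_def)
    have "m \<le> poly p ?S" using m(1) p[of "sz x"] poly_mono_nat[OF sz[OF x], of p] by linarith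
    then have "m * (2 * (?S + K + m)) \<le> poly p ?S * (2 * (?S + K + poly p ?S))"
      by (intro mult_le_mono) auto
    then have "t \<le> poly ?q ?S" using t(1) by (simp add: algebra_simps)
    then show "\<exists>t c. halts_in ?P (init_config (enc x)) t c \<and> reg c 0 = f x \<and> t \<le> poly ?q ?S"
      using t(2) m(3) by (intro exI[of _ t] exI[of _ "conf (length ?P) s"]) (simp add: conf_def)
  qed
qed

section \<open>The program\<close>

lemma triple_ex: "(\<And>x. triple (P x) c N Q) \<Longrightarrow> triple (\<lambda>s. \<exists>x. P x s) c N Q"
  unfolding triple_def by blast

fun block :: "instr list \<Rightarrow> com" where
  "block [i] = Ins i"
| "block (i # j # is) = Ins i ;; block (j # is)"

text \<open>
  Register 1 is left to the loops, a prime marks the counter of remaining rounds of a loop, and \<open>rA\<close> to \<open>rF\<close> are temporaries. While the input is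
  read, \<open>rL\<close> and \<open>rL'\<close> are temporaries as well.
\<close>

abbreviation (input) "rOut \<equiv> 0 :: nat"
abbreviation (input) "rK \<equiv> 2 :: nat"
abbreviation (input) "rN \<equiv> 3 :: nat"
abbreviation (input) "rOne \<equiv> 4 :: nat"
abbreviation (input) "rPtr \<equiv> 5 :: nat"
abbreviation (input) "rI \<equiv> 6 :: nat"
abbreviation (input) "rI' \<equiv> 7 :: nat"
abbreviation (input) "rCount \<equiv> 8 :: nat"
abbreviation (input) "rJ \<equiv> 9 :: nat"
abbreviation (input) "rJ' \<equiv> 10 :: nat"
abbreviation (input) "rL \<equiv> 11 :: nat"
abbreviation (input) "rL' \<equiv> 12 :: nat"
abbreviation (input) "rFound \<equiv> 14 :: nat"
abbreviation (input) "rTotal \<equiv> 15 :: nat"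
abbreviation (input) "rLoad \<equiv> 16 :: nat"
abbreviation (input) "rCand \<equiv> 17 :: nat"
abbreviation (input) "rFrom \<equiv> 18 :: nat"
abbreviation (input) "rTo \<equiv> 19 :: nat"
abbreviation (input) "rBase \<equiv> 20 :: nat"
abbreviation (input) "rTwo \<equiv> 21 :: nat"
abbreviation (input) "rLabPtr \<equiv> 22 :: nat"
abbreviation (input) "rLab \<equiv> 23 :: nat"
abbreviation (input) "rEntPtr \<equiv> 24 :: nat"
abbreviation (input) "rA \<equiv> 25 :: nat"
abbreviation (input) "rB \<equiv> 26 :: nat"
abbreviation (input) "rC \<equiv> 27 :: nat"
abbreviation (input) "rD \<equiv> 28 :: nat"
abbreviation (input) "rE \<equiv> 29 :: nat"
abbreviation (input) "rF \<equiv> 30 :: nat"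
abbreviation (input) "rZero \<equiv> 31 :: nat"

text \<open>
  From address 32 on, the memory holds a matrix with \<open>n\<close> columns. Its first row consists of the labels
  and the others of the entries. The machine cannot multiply; the pointer \<open>rPtr\<close> advances entry by
  entry or row by row instead.
\<close>

definition label_addr :: "nat \<Rightarrow> nat" where
  "label_addr j = 32 + j"

definition entry_addr :: "nat \<Rightarrow> nat \<Rightarrow> nat \<Rightarrow> nat" where
  "entry_addr n i j = 32 + Suc i * n + j"

abbreviation (input) labels :: "(nat \<Rightarrow> nat) \<Rightarrow> nat \<Rightarrow> nat" where
  "labels r j \<equiv> r (label_addr j)"

abbreviation (input) entries :: "nat \<Rightarrow> (nat \<Rightarrow> nat) \<Rightarrow> nat \<Rightarrow> nat \<Rightarrow> nat" where
  "entries n r i j \<equiv> r (entry_addr n i j)"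

lemma addr_neq [simp]:
  "c < 32 \<Longrightarrow> label_addr j \<noteq> c" "c < 32 \<Longrightarrow> entry_addr n i j \<noteq> c"
  "c < 32 \<Longrightarrow> c \<noteq> label_addr j" "c < 32 \<Longrightarrow> c \<noteq> entry_addr n i j"
  "j < n \<Longrightarrow> label_addr j \<noteq> entry_addr n i j'" "j < n \<Longrightarrow> entry_addr n i j' \<noteq> label_addr j"
  by (auto simp: label_addr_def entry_addr_def)

lemma label_addr_eq [simp]: "label_addr j = label_addr j' \<longleftrightarrow> j = j'"
  by (simp add: label_addr_def)

lemma entry_addr_eq [simp]:
  assumes "j < n" "j' < n"
  shows "entry_addr n i j = entry_addr n i' j' \<longleftrightarrow> i = i' \<and> j = j'"
proof
  assume "entry_addr n i j = entry_addr n i' j'"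
  then have eq: "i * n + j = i' * n + j'" by (simp add: entry_addr_def)
  have "i = (i * n + j) div n" "i' = (i' * n + j') div n" using assms by simp_all
  then have "i = i'" using eq by simp
  then show "i = i' \<and> j = j'" using eq by simp
qed simp

lemma entry_addr_simps:
  "Suc (entry_addr n i j) = entry_addr n i (Suc j)"
  "entry_addr n i 0 + j = entry_addr n i j" "entry_addr n i n = entry_addr n (Suc i) 0"
  "entry_addr n i 0 + n = entry_addr n (Suc i) 0"
  by (auto simp: entry_addr_def)

definition constants :: "nat \<Rightarrow> nat \<Rightarrow> (nat \<Rightarrow> nat) \<Rightarrow> bool" where
  "constants n k r \<longleftrightarrow> r rK = k \<and> r rN = n \<and> r rOne = 1 \<and> r rBase = 32 \<and> r rTwo = 2 \<and> r rZero = 0"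

lemma constants_upd [simp]:
  "c \<notin> {rK, rN, rOne, rBase, rTwo, rZero} \<Longrightarrow> constants n k (r(c := x)) \<longleftrightarrow> constants n k r"
  by (auto simp: constants_def)

text \<open>
  Naming the contents \<open>w\<close> and \<open>b\<close> keeps invariants about the arrays untouched by assignments to the
  scalar registers.
\<close>

definition memory :: "nat \<Rightarrow> (nat \<Rightarrow> nat \<Rightarrow> nat) \<Rightarrow> (nat \<Rightarrow> nat) \<Rightarrow> (nat \<Rightarrow> nat) \<Rightarrow> bool" where
  "memory n w b r \<longleftrightarrow> (\<forall>j<n. labels r j = b j) \<and> (\<forall>i<n. \<forall>j<n. entries n r i j = w i j)"

lemma memory_upd [simp]: "c < 32 \<Longrightarrow> memory n w b (r(c := x)) \<longleftrightarrow> memory n w b r"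
  by (simp add: memory_def)

text \<open>
  Each edge read is chosen greedily while its row has chosen fewer than \<open>k\<close>. Truncated differences
  encode tests: \<open>1 - (k - count)\<close> and \<open>1 - x\<close> both vanish exactly if there is an edge that may be chosen.
\<close>

definition read_entry :: com where
  "read_entry =
     block [Read rL, Sub rL' rK rCount, Sub rL' rOne rL', Sub rA rOne rL, Add rL' rL' rA] ;;
     IfZ rL' (block [Add rCount rCount rOne, Add rL rL rOne]) ;;
     block [Store rPtr rL, Add rPtr rPtr rOne]"

definition read_row :: com where
  "read_row = Ins (SetConst rCount 0) ;; For rJ rJ' rN read_entry"

definition read_input :: com where
  "read_input =
     block [Read rK, Read rN, SetConst rBase 32, Add rPtr rBase rN, SetConst rOne 1, SetConst rTwo 2] ;;
     For rI rI' rN read_row"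

lemma card_less_Suc:
  "card {j. j < Suc m \<and> P j} = card {j. j < m \<and> P j} + (if P m then 1 else 0)"
proof -
  have "{j. j < Suc m \<and> P j} = (if P m then insert m {j. j < m \<and> P j} else {j. j < m \<and> P j})"
    by (auto simp: less_Suc_eq)
  then show ?thesis by simp
qed

lemma row_ok_cong: "(\<And>j. j < m \<Longrightarrow> r j = r' j) \<Longrightarrow> row_ok m k a r \<longleftrightarrow> row_ok m k a r'"
proof -
  assume eq: "\<And>j. j < m \<Longrightarrow> r j = r' j"
  then have "{j. j < m \<and> r j = 2} = {j. j < m \<and> r' j = 2}" by auto
  then show ?thesis using eq unfolding row_ok_def by auto
qed

lemma row_ok_Suc:
  assumes "row_ok m k a r" "r m = (if a m then (if card {j. j < m \<and> r j = 2} < k then 2 else 1) else 0)"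
  shows "row_ok (Suc m) k a r"
  using assms unfolding row_ok_def card_less_Suc by (auto simp: less_Suc_eq)

context
  fixes n k :: nat and A :: "nat \<Rightarrow> nat \<Rightarrow> bool"
begin

definition input_row :: "nat \<Rightarrow> nat \<Rightarrow> nat list" where
  "input_row i m = map (\<lambda>j. if A i j then 1 else 0) [m..<n]"

definition input_rows :: "nat \<Rightarrow> nat list" where
  "input_rows m = concat (map (\<lambda>i. input_row i 0) [m..<n])"

definition rows_read :: "nat \<Rightarrow> (nat \<Rightarrow> nat) \<Rightarrow> bool" where
  "rows_read m r \<longleftrightarrow> constants n k r \<and> (\<forall>j<n. labels r j = 0) \<and>
     (\<forall>i<m. row_ok n k (A i) (entries n r i))"

lemma rows_read_upd [simp]:
  "c < 32 \<Longrightarrow> c \<notin> {rK, rN, rOne, rBase, rTwo, rZero} \<Longrightarrow> rows_read m (r(c := x)) \<longleftrightarrow> rows_read m r"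
  by (auto simp: rows_read_def)

definition entries_read :: "nat \<Rightarrow> nat \<Rightarrow> state \<Rightarrow> bool" where
  "entries_read i m = (\<lambda>(r, xs). rows_read i r \<and> xs = input_row i m @ input_rows (Suc i) \<and>
     r rI = i \<and> r rPtr = entry_addr n i m \<and> row_ok m k (A i) (entries n r i) \<and>
     r rCount = card {j. j < m \<and> entries n r i j = 2})"

lemma read_entry_correct:
  assumes "i < n" "m < n"
  shows "triple (\<lambda>s. entries_read i m s \<and> fst s rJ = m) read_entry 10
     (\<lambda>s. entries_read i (Suc m) s \<and> fst s rJ = m)"
proof -
  have lf: "loop_free read_entry" by (simp add: read_entry_def)
  have "entries_read i (Suc m) (sem read_entry (r, xs)) \<and> fst (sem read_entry (r, xs)) rJ = m"
    if pre: "entries_read i m (r, xs)" "r rJ = m" for r xs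
  proof -
    let ?cnt = "card {j. j < m \<and> entries n r i j = 2}"
    let ?v = "if A i m then (if ?cnt < k then 2 else 1) else (0 :: nat)"
    have xs: "xs = (if A i m then 1 else 0) # (input_row i (Suc m) @ input_rows (Suc i))"
      using pre assms by (simp add: entries_read_def input_row_def upt_conv_Cons)
    have c: "r rK = k" "r rOne = 1" "r rCount = ?cnt" "r rPtr = entry_addr n i m"
      using pre by (auto simp: entries_read_def rows_read_def constants_def)
    obtain r' where sem: "sem read_entry (r, xs) = (r', input_row i (Suc m) @ input_rows (Suc i))"
      and r': "\<And>a. a \<notin> {rL, rL', rA, rCount, rPtr, entry_addr n i m} \<Longrightarrow> r' a = r a"
        "r' (entry_addr n i m) = ?v" "r' rPtr = entry_addr n i m + 1"
        "r' rCount = (if ?v = 2 then ?cnt + 1 else ?cnt)"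
      unfolding xs by (cases "A i m"; cases "?cnt < k") (simp_all add: read_entry_def c)
    have old: "entries n r' i' j = entries n r i' j" if "j < n" "i' \<noteq> i \<or> j \<noteq> m" for i' j
      using that assms by (intro r') auto
    have "row_ok m k (A i) (entries n r i)" using pre by (simp add: entries_read_def)
    then have ok: "row_ok m k (A i) (entries n r' i)"
      using row_ok_cong[of m "entries n r i" "entries n r' i" k "A i"] old assms by auto
    have cnt: "?cnt = card {j. j < m \<and> entries n r' i j = 2}"
      by (rule arg_cong[of _ _ card]) (use old assms in auto)
    have "row_ok (Suc m) k (A i) (entries n r' i)"
      by (rule row_ok_Suc[OF ok]) (use r'(2) cnt in simp)
    moreover have "r' rCount = card {j. j < Suc m \<and> entries n r' i j = 2}"
      unfolding card_less_Suc cnt[symmetric] r'(2,4) by simp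
    moreover have "rows_read i r'"
    proof -
      have "row_ok n k (A i') (entries n r' i')" if "i' < i" for i'
        using row_ok_cong[of n "entries n r i'" "entries n r' i'" k "A i'"] old pre that
        by (auto simp: entries_read_def rows_read_def)
      moreover have "labels r' j = 0" if "j < n" for j
        using r'(1)[of "label_addr j"] that pre by (simp add: entries_read_def rows_read_def)
      moreover have "constants n k r'"
        using pre by (simp add: entries_read_def rows_read_def constants_def r'(1))
      ultimately show ?thesis by (simp add: rows_read_def)
    qed
    ultimately show ?thesis
      unfolding sem using pre r'(1)[of rI] r'(1)[of rJ] r'(3)
      by (simp add: entries_read_def entry_addr_simps)
  qed
  then have "triple (\<lambda>s. entries_read i m s \<and> fst s rJ = m) read_entry (clen read_entry)
     (\<lambda>s. entries_read i (Suc m) s \<and> fst s rJ = m)"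
    by (intro triple_loop_free[OF lf]) auto
  then show ?thesis by (rule triple_conseq) (auto simp: read_entry_def)
qed

definition input_inv :: "nat \<Rightarrow> state \<Rightarrow> bool" where
  "input_inv i = (\<lambda>(r, xs). rows_read i r \<and> xs = input_rows i \<and> r rPtr = entry_addr n i 0)"

lemma read_row_correct:
  assumes "i < n"
  shows "triple (\<lambda>s. input_inv i s \<and> fst s rI = i) read_row ((n + 1) * 14 + 6)
     (\<lambda>s. input_inv (Suc i) s \<and> fst s rI = i)"
proof -
  have "triple (\<lambda>s. input_inv i s \<and> fst s rI = i) (Ins (SetConst rCount 0)) (clen (Ins (SetConst rCount 0)))
     (entries_read i 0)"
  proof (rule triple_loop_free)
    fix r xs assume pre: "input_inv i (r, xs) \<and> fst (r, xs) rI = i"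
    have "input_rows i = input_row i 0 @ input_rows (Suc i)"
      using assms by (simp add: input_rows_def upt_conv_Cons)
    then show "entries_read i 0 (sem (Ins (SetConst rCount 0)) (r, xs))"
      using pre by (simp add: input_inv_def entries_read_def row_ok_def)
  qed simp
  moreover have "triple (entries_read i 0) (For rJ rJ' rN read_entry) ((n + 1) * (10 + 4) + 5) (entries_read i n)"
  proof (rule triple_For[OF read_entry_correct])
    fix m s xs x y z assume "entries_read i m (s, xs)"
    then show "entries_read i m (s(rJ := x, rJ' := y, 1 := z), xs)" by (simp add: entries_read_def)
  next
    fix m s xs assume "entries_read i m (s, xs)"
    then show "s rN = n" by (simp add: entries_read_def rows_read_def constants_def)
  qed (use assms in simp_all)
  ultimately have "triple (\<lambda>s. input_inv i s \<and> fst s rI = i) read_row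
      (clen (Ins (SetConst rCount 0)) + ((n + 1) * (10 + 4) + 5)) (entries_read i n)"
    unfolding read_row_def by (rule triple_Seq)
  then show ?thesis
    by (rule triple_conseq)
       (auto simp: entries_read_def input_inv_def input_row_def rows_read_def less_Suc_eq entry_addr_simps)
qed

lemma read_input_correct:
  "triple (\<lambda>s. s = (\<lambda>_. 0, k # n # input_rows 0)) read_input ((n + 1) * ((n + 1) * 14 + 10) + 11)
     (\<lambda>(r, xs). constants n k r \<and> valid n k A (entries n r) (labels r) \<and> (\<forall>j<n. labels r j = 0))"
proof -
  let ?init = "block [Read rK, Read rN, SetConst rBase 32, Add rPtr rBase rN, SetConst rOne 1, SetConst rTwo 2]"
  have "triple (\<lambda>s. s = (\<lambda>_. 0, k # n # input_rows 0)) ?init (clen ?init) (input_inv 0)"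
    by (rule triple_loop_free)
       (auto simp: input_inv_def rows_read_def constants_def entry_addr_def)
  moreover have "triple (input_inv 0) (For rI rI' rN read_row)
      ((n + 1) * (((n + 1) * 14 + 6) + 4) + 5) (input_inv n)"
  proof (rule triple_For[OF read_row_correct])
    fix i s xs x y z assume "input_inv i (s, xs)"
    then show "input_inv i (s(rI := x, rI' := y, 1 := z), xs)" by (simp add: input_inv_def)
  next
    fix i s xs assume "input_inv i (s, xs)"
    then show "s rN = n" by (simp add: input_inv_def rows_read_def constants_def)
  qed simp_all
  ultimately have "triple (\<lambda>s. s = (\<lambda>_. 0, k # n # input_rows 0)) read_input
      (clen ?init + ((n + 1) * (((n + 1) * 14 + 6) + 4) + 5)) (input_inv n)"
    unfolding read_input_def by (rule triple_Seq)
  then show ?thesis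
    by (rule triple_conseq) (auto simp: input_inv_def rows_read_def valid_def)
qed

end


text \<open>
  \<open>rD\<close> becomes zero exactly if the entry is 1 and its column has a smaller label than the current one:
  \<open>1 - (b j - b l)\<close> tests the labels, while \<open>x - 1\<close> and \<open>1 - x\<close> together test \<open>x = 1\<close>.
\<close>

definition scan_entry :: com where
  "scan_entry =
     block [Add rB rPtr rL, Load rC rB, Add rD rBase rL, Load rD rD,
       Sub rD rLab rD, Sub rD rOne rD, Sub rE rC rOne, Sub rF rOne rC, Add rD rD rE, Add rD rD rF] ;;
     IfZ rD (block [SetConst rCand 1, Add rFrom rEntPtr rZero, Add rTo rB rZero])"

definition scan_row :: com where
  "scan_row =
     block [Add rEntPtr rPtr rJ, Load rA rEntPtr, Sub rA rTwo rA] ;;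
     IfZ rA (Ins (Add rLoad rLoad rOne) ;; For rL rL' rN scan_entry) ;;
     Ins (Add rPtr rPtr rN)"

definition scan_column :: com where
  "scan_column =
     block [SetConst rLoad 0, SetConst rCand 0, Add rLabPtr rBase rJ, Load rLab rLabPtr, Add rPtr rBase rN] ;;
     For rI rI' rN scan_row"

text \<open>
  \<open>min (load j) k\<close> is computed as the load minus its excess over \<open>k\<close>. The outer test succeeds if the
  column is overloaded and its label is at most \<open>n\<close>. Of the two inner branches exactly one is taken, because
  \<open>rB\<close> is the negation of \<open>rCand\<close>.
\<close>

definition update_column :: com where
  "update_column =
     block [Sub rA rLoad rK, Sub rB rLoad rA, Add rTotal rTotal rB,
       Add rB rN rOne, Sub rB rB rLab, Sub rA rOne rA, Sub rB rOne rB, Add rA rA rB] ;;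
     IfZ rA (
       block [SetConst rFound 1, Sub rB rOne rCand] ;;
       IfZ rCand (block [Add rLab rLab rOne, Store rLabPtr rLab]) ;;
       IfZ rB (block [Store rFrom rOne, Store rTo rTwo]))"

definition sweep :: com where
  "sweep = block [SetConst rFound 0, SetConst rTotal 0] ;;
     For rJ rJ' rN (scan_column ;; update_column)"

context
  fixes n k :: nat and w :: "nat \<Rightarrow> nat \<Rightarrow> nat" and b :: "nat \<Rightarrow> nat" and j :: nat
    and found tot :: nat
begin

definition candidate :: "nat \<Rightarrow> nat \<Rightarrow> bool" where
  "candidate i l \<longleftrightarrow> w i j = 2 \<and> w i l = 1 \<and> b l < b j"

text \<open>
  \<open>S\<close> is the set of positions examined so far.
\<close>

definition recorded :: "(nat \<Rightarrow> nat \<Rightarrow> bool) \<Rightarrow> (nat \<Rightarrow> nat) \<Rightarrow> bool" where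
  "recorded S r \<longleftrightarrow>
     (r rCand = 0 \<and> (\<forall>i<n. \<forall>l<n. S i l \<longrightarrow> \<not> candidate i l)) \<or>
     (r rCand = 1 \<and> (\<exists>i<n. \<exists>l<n. candidate i l \<and> r rFrom = entry_addr n i j \<and> r rTo = entry_addr n i l))"

lemma recorded_upd [simp]:
  "c \<notin> {rCand, rFrom, rTo} \<Longrightarrow> recorded S (r(c := x)) \<longleftrightarrow> recorded S r"
  by (auto simp: recorded_def)

definition scanning :: "(nat \<Rightarrow> nat) \<Rightarrow> bool" where
  "scanning r \<longleftrightarrow> constants n k r \<and> memory n w b r \<and> r rJ = j \<and> r rFound = found \<and> r rTotal = tot \<and>
     r rLabPtr = label_addr j \<and> r rLab = b j"

lemma scanning_upd [simp]:
  "c < 32 \<Longrightarrow> c \<notin> {rK, rN, rOne, rBase, rTwo, rZero, rJ, rFound, rTotal, rLabPtr, rLab} \<Longrightarrow>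
   scanning (r(c := x)) \<longleftrightarrow> scanning r"
  by (auto simp: scanning_def)

text \<open>
  The load already includes row \<open>i\<close>, because a row is scanned only after its entry in column \<open>j\<close> has
  been found to be chosen and counted.
\<close>

definition row_inv :: "nat \<Rightarrow> nat \<Rightarrow> state \<Rightarrow> bool" where
  "row_inv i l = (\<lambda>(r, xs). scanning r \<and> r rI = i \<and> r rPtr = entry_addr n i 0 \<and> r rEntPtr = entry_addr n i j \<and>
     r rLoad = card {i'. i' < Suc i \<and> w i' j = 2} \<and>
     recorded (\<lambda>i' l'. i' < i \<or> i' = i \<and> l' < l) r)"

lemma scan_entry_correct:
  assumes j: "j < n" and i: "i < n" "w i j = 2" and l: "l < n"
  shows "triple (\<lambda>s. row_inv i l s \<and> fst s rL = l) scan_entry 14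
     (\<lambda>s. row_inv i (Suc l) s \<and> fst s rL = l)"
proof -
  have lf: "loop_free scan_entry" by (simp add: scan_entry_def)
  have "row_inv i (Suc l) (sem scan_entry (r, xs)) \<and> fst (sem scan_entry (r, xs)) rL = l"
    if pre: "row_inv i l (r, xs)" "r rL = l" for r xs
  proof -
    have c: "r rBase = 32" "r rOne = 1" "r rZero = 0" "r rPtr = entry_addr n i 0" "r rLab = b j"
      "r rEntPtr = entry_addr n i j" "r (entry_addr n i l) = w i l" "r (label_addr l) = b l"
      using pre i l by (auto simp: row_inv_def scanning_def constants_def memory_def)
    let ?r = "fst (sem scan_entry (r, xs))"
    have la: "32 + l = label_addr l" by (simp add: label_addr_def)
    define d where "d = (1 - (b j - b l)) + (w i l - 1) + (1 - w i l)"
    let ?r0 = "r(rB := entry_addr n i l, rC := w i l, rD := d,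
       rE := w i l - 1, rF := 1 - w i l)"
    have r0: "sem (block [Add rB rPtr rL, Load rC rB, Add rD rBase rL, Load rD rD,
       Sub rD rLab rD, Sub rD rOne rD, Sub rE rC rOne, Sub rF rOne rC, Add rD rD rE, Add rD rD rF]) (r, xs) = (?r0, xs)"
      using pre(2) unfolding d_def by (simp add: c la entry_addr_simps) (rule ext, simp)
    have test: "d = 0 \<longleftrightarrow> candidate i l"
      using i(2) unfolding d_def by (auto simp: candidate_def)
    show ?thesis
    proof (cases "candidate i l")
      case True
      then have "sem scan_entry (r, xs) = (?r0(rCand := 1, rFrom := entry_addr n i j, rTo := entry_addr n i l), xs)"
        unfolding scan_entry_def sem.simps r0 using test by (simp add: c)
      then show ?thesis using pre i l True by (auto simp: row_inv_def recorded_def)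
    next
      case False
      then have "sem scan_entry (r, xs) = (?r0, xs)"
        unfolding scan_entry_def sem.simps r0 using test by simp
      moreover have "recorded (\<lambda>i' l'. i' < i \<or> i' = i \<and> l' < Suc l) r"
        using pre False unfolding row_inv_def recorded_def by (auto simp: less_Suc_eq)
      ultimately show ?thesis using pre by (simp add: row_inv_def)
    qed
  qed
  then have "triple (\<lambda>s. row_inv i l s \<and> fst s rL = l) scan_entry (clen scan_entry)
     (\<lambda>s. row_inv i (Suc l) s \<and> fst s rL = l)"
    by (intro triple_loop_free[OF lf]) auto
  then show ?thesis by (rule triple_conseq) (auto simp: scan_entry_def)
qed

definition column_inv :: "nat \<Rightarrow> state \<Rightarrow> bool" where
  "column_inv i = (\<lambda>(r, xs). scanning r \<and> r rPtr = entry_addr n i 0 \<and>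
     r rLoad = card {i'. i' < i \<and> w i' j = 2} \<and> recorded (\<lambda>i' l'. i' < i) r)"

lemma scan_row_correct:
  assumes w_le: "\<And>i j. i < n \<Longrightarrow> j < n \<Longrightarrow> w i j \<le> 2" and j: "j < n" and i: "i < n"
  shows "triple (\<lambda>s. column_inv i s \<and> fst s rI = i) scan_row ((n + 1) * 18 + 11)
     (\<lambda>s. column_inv (Suc i) s \<and> fst s rI = i)"
proof -
  let ?start = "block [Add rEntPtr rPtr rJ, Load rA rEntPtr, Sub rA rTwo rA]"
  let ?mid = "\<lambda>(r, xs). column_inv i (r, xs) \<and> r rI = i \<and> r rEntPtr = entry_addr n i j \<and> r rA = 2 - w i j"
  let ?post = "\<lambda>(r, xs). scanning r \<and> r rI = i \<and> r rPtr = entry_addr n i 0 \<and>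
     r rLoad = card {i'. i' < Suc i \<and> w i' j = 2} \<and> recorded (\<lambda>i' l'. i' < Suc i) r"
  have 1: "triple (\<lambda>s. column_inv i s \<and> fst s rI = i) ?start (clen ?start) ?mid"
  proof (rule triple_loop_free)
    fix r xs assume pre: "column_inv i (r, xs) \<and> fst (r, xs) rI = i"
    then have "r rTwo = 2" "r rPtr = entry_addr n i 0" "r rJ = j" "r (entry_addr n i j) = w i j"
      using i j by (auto simp: column_inv_def scanning_def constants_def memory_def)
    then show "?mid (sem ?start (r, xs))" using pre by (simp add: column_inv_def entry_addr_simps)
  qed simp
  have "triple (\<lambda>s. ?mid s \<and> fst s rA = 0) (Ins (Add rLoad rLoad rOne) ;; For rL rL' rN scan_entry)
      (clen (Ins (Add rLoad rLoad rOne)) + ((n + 1) * (14 + 4) + 5)) ?post"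
  proof (cases "w i j = 2")
    case True
    have "triple (\<lambda>s. ?mid s \<and> fst s rA = 0) (Ins (Add rLoad rLoad rOne)) (clen (Ins (Add rLoad rLoad rOne))) (row_inv i 0)"
    proof (rule triple_loop_free)
      fix r xs assume "?mid (r, xs) \<and> fst (r, xs) rA = 0"
      moreover from this have "r rOne = 1" by (simp add: column_inv_def scanning_def constants_def)
      ultimately show "row_inv i 0 (sem (Ins (Add rLoad rLoad rOne)) (r, xs))"
        using True by (simp add: row_inv_def column_inv_def card_less_Suc)
    qed simp
    moreover have "triple (row_inv i 0) (For rL rL' rN scan_entry) ((n + 1) * (14 + 4) + 5) (row_inv i n)"
    proof (rule triple_For[OF scan_entry_correct[OF j i True]])
      fix l s xs x y z assume "row_inv i l (s, xs)"
      then show "row_inv i l (s(rL := x, rL' := y, 1 := z), xs)" by (simp add: row_inv_def)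
    next
      fix l s xs assume "row_inv i l (s, xs)"
      then show "s rN = n" by (simp add: row_inv_def scanning_def constants_def)
    qed simp_all
    ultimately have "triple (\<lambda>s. ?mid s \<and> fst s rA = 0) (Ins (Add rLoad rLoad rOne) ;; For rL rL' rN scan_entry)
      (clen (Ins (Add rLoad rLoad rOne)) + ((n + 1) * (14 + 4) + 5)) (row_inv i n)"
      by (rule triple_Seq)
    then show ?thesis
      by (rule triple_conseq) (auto simp: row_inv_def recorded_def less_Suc_eq)
  next
    case False
    then have "w i j < 2" using w_le[OF i j] by simp
    then show ?thesis unfolding triple_def by auto
  qed
  then have 2: "triple ?mid (IfZ rA (Ins (Add rLoad rLoad rOne) ;; For rL rL' rN scan_entry))
      (clen (Ins (Add rLoad rLoad rOne)) + ((n + 1) * (14 + 4) + 5) + 1) ?post"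
  proof (rule triple_IfZ)
    fix r and xs :: "nat list" assume m: "?mid (r, xs)" "r rA > 0"
    then have "w i j \<noteq> 2" by simp
    moreover from this have "recorded (\<lambda>i' l'. i' < Suc i) r"
      using m by (auto simp: column_inv_def recorded_def less_Suc_eq candidate_def)
    ultimately show "?post (r, xs)" using m by (simp add: column_inv_def card_less_Suc)
  qed
  have 3: "triple ?post (Ins (Add rPtr rPtr rN)) (clen (Ins (Add rPtr rPtr rN)))
     (\<lambda>s. column_inv (Suc i) s \<and> fst s rI = i)"
  proof (rule triple_loop_free)
    fix r and xs :: "nat list" assume "?post (r, xs)"
    moreover from this have "r rN = n" by (simp add: scanning_def constants_def)
    ultimately show "column_inv (Suc i) (sem (Ins (Add rPtr rPtr rN)) (r, xs)) \<and>
        fst (sem (Ins (Add rPtr rPtr rN)) (r, xs)) rI = i"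
      by (simp add: column_inv_def entry_addr_simps)
  qed simp
  from triple_Seq[OF 1 triple_Seq[OF 2 3]]
  show ?thesis unfolding scan_row_def by (rule triple_conseq) auto
qed

lemma scan_column_correct:
  assumes w_le: "\<And>i j. i < n \<Longrightarrow> j < n \<Longrightarrow> w i j \<le> 2" and j: "j < n"
  shows "triple (\<lambda>(r, xs). constants n k r \<and> memory n w b r \<and> r rJ = j \<and> r rFound = found \<and> r rTotal = tot)
     scan_column ((n + 1) * ((n + 1) * 18 + 15) + 10)
     (\<lambda>(r, xs). scanning r \<and> r rLoad = load n w j \<and> recorded (\<lambda>i l. True) r)"
proof -
  let ?start = "block [SetConst rLoad 0, SetConst rCand 0, Add rLabPtr rBase rJ, Load rLab rLabPtr, Add rPtr rBase rN]"
  let ?pre = "\<lambda>(r, xs). constants n k r \<and> memory n w b r \<and> r rJ = j \<and> r rFound = found \<and> r rTotal = tot"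
  have "triple ?pre ?start (clen ?start) (column_inv 0)"
  proof (rule triple_loop_free)
    fix r and xs :: "nat list" assume pre: "?pre (r, xs)"
    then have c: "r rBase = 32" "r rN = n" "r rJ = j" "r (label_addr j) = b j"
      using j by (auto simp: constants_def memory_def)
    have "32 + j = label_addr j" "32 + n = entry_addr n 0 0" by (auto simp: label_addr_def entry_addr_def)
    then show "column_inv 0 (sem ?start (r, xs))"
      using pre c by (simp add: column_inv_def scanning_def recorded_def)
  qed simp
  moreover have "triple (column_inv 0) (For rI rI' rN scan_row) ((n + 1) * (((n + 1) * 18 + 11) + 4) + 5) (column_inv n)"
  proof (rule triple_For[OF scan_row_correct[OF w_le j]])
    fix i s xs x y z assume "column_inv i (s, xs)"
    then show "column_inv i (s(rI := x, rI' := y, 1 := z), xs)" by (simp add: column_inv_def)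
  next
    fix i s xs assume "column_inv i (s, xs)"
    then show "s rN = n" by (simp add: column_inv_def scanning_def constants_def)
  qed simp_all
  ultimately have "triple ?pre scan_column (clen ?start + ((n + 1) * (((n + 1) * 18 + 11) + 4) + 5)) (column_inv n)"
    unfolding scan_column_def by (rule triple_Seq)
  then show ?thesis
    by (rule triple_conseq) (auto simp: column_inv_def load_def recorded_def)
qed

end


lemma memory_entries: "memory n (entries n r) (labels r) r"
  by (simp add: memory_def)

lemma memory_cong:
  assumes "memory n w b r"
  shows "valid n k A (entries n r) (labels r) \<longleftrightarrow> valid n k A w b"
    and "potential n (entries n r) (labels r) = potential n w b"
    and "j < n \<Longrightarrow> load n (entries n r) j = load n w j"
proof -
  have e: "entries n r i j = w i j" if "i < n" "j < n" for i j using assms that by (simp add: memory_def)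
  have l: "labels r j = b j" if "j < n" for j using assms that by (simp add: memory_def)
  have load: "load n (entries n r) j = load n w j" if "j < n" for j
    using e that by (intro load_cong) auto
  then show "j < n \<Longrightarrow> load n (entries n r) j = load n w j" .
  show "potential n (entries n r) (labels r) = potential n w b"
    using e l by (intro potential_cong) auto
  have "row_ok n k (A i) (entries n r i) \<longleftrightarrow> row_ok n k (A i) (w i)" if "i < n" for i
    using e[OF that] by (intro row_ok_cong) auto
  then show "valid n k A (entries n r) (labels r) \<longleftrightarrow> valid n k A w b"
    unfolding valid_def using e l load by auto
qed

text \<open>
  Either nothing has changed in the current sweep, so that the partial sum and the test for termination
  still refer to the present state, or the potential has dropped below its value \<open>p\<close> at the start of the sweep
  and the sum is worthless.
\<close>

definition sweep_inv :: "nat \<Rightarrow> nat \<Rightarrow> (nat \<Rightarrow> nat \<Rightarrow> bool) \<Rightarrow> nat \<Rightarrow> nat \<Rightarrow> (nat \<Rightarrow> nat) \<Rightarrow> bool" where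
  "sweep_inv n k A p m r \<longleftrightarrow> constants n k r \<and> valid n k A (entries n r) (labels r) \<and>
     (r rFound = 0 \<and> potential n (entries n r) (labels r) = p \<and>
        r rTotal = (\<Sum>j<m. min (load n (entries n r) j) k) \<and>
        (\<forall>j<m. load n (entries n r) j \<le> k \<or> labels r j = n + 1) \<or>
      r rFound = 1 \<and> potential n (entries n r) (labels r) < p)"

lemma sweep_inv_memory:
  assumes "memory n w b r" "m \<le> n"
  shows "sweep_inv n k A p m r \<longleftrightarrow> constants n k r \<and> valid n k A w b \<and>
     (r rFound = 0 \<and> potential n w b = p \<and> r rTotal = (\<Sum>j<m. min (load n w j) k) \<and>
        (\<forall>j<m. load n w j \<le> k \<or> b j = n + 1) \<or>
      r rFound = 1 \<and> potential n w b < p)"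
proof -
  have "(\<Sum>j<m. min (load n (entries n r) j) k) = (\<Sum>j<m. min (load n w j) k)"
    using assms memory_cong(3)[OF assms(1)] by (intro sum.cong) auto
  moreover have "(\<forall>j<m. load n (entries n r) j \<le> k \<or> labels r j = n + 1) \<longleftrightarrow>
     (\<forall>j<m. load n w j \<le> k \<or> b j = n + 1)"
    using assms memory_cong(3)[OF assms(1)] by (auto simp: memory_def)
  ultimately show ?thesis
    unfolding sweep_inv_def using memory_cong(1,2)[OF assms(1)] by simp
qed

lemma update_column_correct:
  assumes j: "j < n" and v: "valid n k A w b"
    and before: "found = 0 \<and> potential n w b = p \<and> tot = (\<Sum>l<j. min (load n w l) k) \<and>
        (\<forall>l<j. load n w l \<le> k \<or> b l = n + 1) \<or> found = 1 \<and> potential n w b < p"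
  shows "triple (\<lambda>(r, xs). scanning n k w b j found tot r \<and> r rLoad = load n w j \<and>
       recorded n w b j (\<lambda>i l. True) r)
     update_column 18 (\<lambda>(r, xs). sweep_inv n k A p (Suc j) r \<and> r rJ = j)"
proof -
  have lf: "loop_free update_column" by (simp add: update_column_def)
  let ?Q = "\<lambda>(r, xs). sweep_inv n k A p (Suc j) r \<and> r rJ = j"
  have "?Q (sem update_column (r, xs))"
    if pre: "scanning n k w b j found tot r" "r rLoad = load n w j" "recorded n w b j (\<lambda>i l. True) r"
    for r and xs :: "nat list"
  proof -
    let ?test = "block [Sub rA rLoad rK, Sub rB rLoad rA, Add rTotal rTotal rB,
       Add rB rN rOne, Sub rB rB rLab, Sub rA rOne rA, Sub rB rOne rB, Add rA rA rB]"
    have c: "r rK = k" "r rN = n" "r rOne = 1" "r rTwo = 2" "r rTotal = tot" "r rLab = b j"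
      "r rLabPtr = label_addr j" "r rFound = found" "r rJ = j"
      and mem: "memory n w b r" and cs: "constants n k r"
      using pre(1) by (auto simp: scanning_def constants_def)
    define a where "a = (1 - (load n w j - k)) + (1 - (n + 1 - b j))"
    define B where "B = 1 - (n + 1 - b j)"
    let ?r0 = "r(rTotal := tot + min (load n w j) k, rB := B, rA := a)"
    have r0: "sem ?test (r, xs) = (?r0, xs)"
      unfolding a_def B_def by (simp add: c pre(2)) (rule ext, auto)
    have mem0: "memory n w b ?r0" using mem by simp
    show ?thesis
    proof (cases "a = 0")
      case False
      then have "load n w j \<le> k \<or> b j = n + 1" using v j unfolding a_def valid_def by fastforce
      then have "sweep_inv n k A p (Suc j) ?r0"
        unfolding sweep_inv_memory[OF mem0 Suc_leI[OF j]]
        using before v cs c by (auto simp: less_Suc_eq)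
      then show ?thesis unfolding update_column_def sem.simps r0 using False c by simp
    next
      case True
      then have act: "k < load n w j" "b j \<le> n" by (auto simp: a_def)
      have pot: "potential n w b \<le> p" using before by auto
      from pre(3) show ?thesis unfolding recorded_def
      proof (elim disjE conjE bexE exE)
        assume cand: "r rCand = 0" and "\<forall>i<n. \<forall>l<n. True \<longrightarrow> \<not> candidate w b j i l"
        then have stuck: "b j \<le> b l" if "i < n" "l < n" "w i j = 2" "w i l = 1" for i l
          using that by (auto simp: candidate_def not_less)
        let ?b = "b(j := b j + 1)"
        let ?r1 = "?r0(rFound := 1, rB := 1, rLab := b j + 1, label_addr j := b j + 1)"
        have eq: "sem update_column (r, xs) = (?r1, xs)"
          unfolding update_column_def sem.simps r0 using True cand c by simp
        have "memory n w ?b ?r1" using mem j by (auto simp: memory_def)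
        moreover have "valid n k A w ?b" by (rule relabel_valid(1)[OF v j act]) (rule stuck)
        moreover have "potential n w ?b < potential n w b"
          by (rule relabel_valid(2)[OF v j act]) (rule stuck)
        ultimately have "sweep_inv n k A p (Suc j) ?r1"
          using sweep_inv_memory[of n w ?b ?r1 "Suc j" k A p] j cs pot by (simp add: constants_def)
        then show ?thesis using c by (simp add: eq)
      next
        fix i l assume cand: "r rCand = 1" and il: "i < n" "l < n" "candidate w b j i l"
          and ptr: "r rFrom = entry_addr n i j" "r rTo = entry_addr n i l"
        let ?w = "move i j l w"
        let ?r1 = "?r0(rFound := 1, rB := 0, entry_addr n i j := 1, entry_addr n i l := 2)"
        have "sem update_column (r, xs) = (?r1, xs)"
          unfolding update_column_def sem.simps r0 using True cand c ptr by simp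
        moreover have "memory n ?w b ?r1" using mem j il by (auto simp: memory_def move_def)
        then have "sweep_inv n k A p (Suc j) ?r1"
          using sweep_inv_memory[of n ?w b ?r1 "Suc j" k A p] j cs pot
            move_valid[OF v il(1) j il(2) act(1)] il(3) by (simp add: constants_def candidate_def)
        ultimately show ?thesis using c by simp
      qed
    qed
  qed
  then have "triple (\<lambda>(r, xs). scanning n k w b j found tot r \<and> r rLoad = load n w j \<and>
       recorded n w b j (\<lambda>i l. True) r) update_column (clen update_column) ?Q"
    by (intro triple_loop_free[OF lf]) auto
  then show ?thesis by (rule triple_conseq) (auto simp: update_column_def)
qed

definition sweep_steps :: "nat \<Rightarrow> nat" where
  "sweep_steps n = (n + 1) * ((n + 1) * ((n + 1) * 18 + 15) + 32) + 7"

lemma sweep_correct: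
  "triple (\<lambda>(r, xs). constants n k r \<and> valid n k A (entries n r) (labels r) \<and>
       potential n (entries n r) (labels r) = p)
     sweep (sweep_steps n) (\<lambda>(r, xs). sweep_inv n k A p n r)"
proof -
  let ?start = "block [SetConst rFound 0, SetConst rTotal 0]"
  let ?I = "\<lambda>j (r, xs). sweep_inv n k A p j r"
  have 1: "triple (\<lambda>(r, xs). constants n k r \<and> valid n k A (entries n r) (labels r) \<and>
       potential n (entries n r) (labels r) = p) ?start (clen ?start) (?I 0)"
    by (rule triple_loop_free) (auto simp: sweep_inv_def)
  have upd: "?I m (s(rJ := x, rJ' := y, 1 := z), xs)" if "?I m (s, xs)" for m s xs x y z
    using that by (simp add: sweep_inv_def)
  have body: "triple (\<lambda>s. ?I j s \<and> fst s rJ = j) (scan_column ;; update_column)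
     (((n + 1) * ((n + 1) * 18 + 15) + 10) + 18) (\<lambda>s. ?I (Suc j) s \<and> fst s rJ = j)" if j: "j < n" for j
  proof -
    let ?P = "\<lambda>(w, b, found, tot) (r, xs). (constants n k r \<and> memory n w b r \<and> r rJ = j \<and>
        r rFound = found \<and> r rTotal = tot) \<and> valid n k A w b \<and>
        (found = 0 \<and> potential n w b = p \<and> tot = (\<Sum>l<j. min (load n w l) k) \<and>
        (\<forall>l<j. load n w l \<le> k \<or> b l = n + 1) \<or> found = 1 \<and> potential n w b < p)"
    have "triple (\<lambda>s. \<exists>y. ?P y s) (scan_column ;; update_column)
     (((n + 1) * ((n + 1) * 18 + 15) + 10) + 18) (\<lambda>(r, xs). sweep_inv n k A p (Suc j) r \<and> r rJ = j)"
    proof (rule triple_ex)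
      fix y :: "(nat \<Rightarrow> nat \<Rightarrow> nat) \<times> (nat \<Rightarrow> nat) \<times> nat \<times> nat"
      obtain w b found tot where y: "y = (w, b, found, tot)" by (cases y) auto
      show "triple (?P y) (scan_column ;; update_column)
        (((n + 1) * ((n + 1) * 18 + 15) + 10) + 18) (\<lambda>(r, xs). sweep_inv n k A p (Suc j) r \<and> r rJ = j)"
      proof (cases "valid n k A w b \<and>
        (found = 0 \<and> potential n w b = p \<and> tot = (\<Sum>l<j. min (load n w l) k) \<and>
        (\<forall>l<j. load n w l \<le> k \<or> b l = n + 1) \<or> found = 1 \<and> potential n w b < p)")
        case True
        then have v: "valid n k A w b" and before: "found = 0 \<and> potential n w b = p \<and>
            tot = (\<Sum>l<j. min (load n w l) k) \<and> (\<forall>l<j. load n w l \<le> k \<or> b l = n + 1) \<or>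
            found = 1 \<and> potential n w b < p" by auto
        have w_le: "w i l \<le> 2" if "i < n" "l < n" for i l
          using v that by (simp add: valid_def row_ok_def)
        show ?thesis
          by (rule triple_conseq[OF triple_Seq[OF scan_column_correct[where w = w and b = b and
                 found = found and tot = tot, OF w_le j] update_column_correct[OF j v before]]])
             (auto simp: y)
      next
        case False
        then show ?thesis unfolding triple_def y by auto
      qed
    qed
    then show ?thesis
    proof (rule triple_conseq)
      fix r and xs :: "nat list" assume "?I j (r, xs) \<and> fst (r, xs) rJ = j"
      then have "?P (entries n r, labels r, r rFound, r rTotal) (r, xs)"
        using memory_entries[of n r] by (simp add: sweep_inv_def)
      then show "\<exists>y. ?P y (r, xs)" by blast
    qed auto
  qed
  have 2: "triple (?I 0) (For rJ rJ' rN (scan_column ;; update_column))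
     ((n + 1) * ((((n + 1) * ((n + 1) * 18 + 15) + 10) + 18) + 4) + 5) (?I n)"
    by (rule triple_For[OF body upd]) (auto simp: sweep_inv_def constants_def)
  from triple_Seq[OF 1 2] show ?thesis
    unfolding sweep_def by (rule triple_conseq) (auto simp: sweep_steps_def)
qed


text \<open>
  The input is even, so truncated subtraction never loses a unit.
\<close>

definition halve :: com where
  "halve = Ins (SetConst rOut 0) ;; While rTotal (block [Sub rTotal rTotal rTwo, Add rOut rOut rOne])"

definition matching_program :: com where
  "matching_program = read_input ;; Rep sweep rFound ;; halve"

definition matching_steps :: "nat \<Rightarrow> nat" where
  "matching_steps n = ((n + 1) * ((n + 1) * 14 + 10) + 11) +
     ((n * ((n + 1) * (n + 1)) + 1) * (sweep_steps n + 1) + ((n * n + 1) * 3 + 4))"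

lemma halve_correct:
  "triple (\<lambda>(r, xs). constants n k r \<and> r rTotal = 2 * v \<and> 2 * v \<le> n * n)
     halve ((n * n + 1) * 3 + 4) (\<lambda>s. fst s rOut = v)"
proof -
  let ?P = "\<lambda>s :: state. fst s rOne = 1 \<and> fst s rTwo = 2 \<and> 2 * fst s rOut + fst s rTotal = 2 * v"
  let ?f = "\<lambda>s :: state. fst s rTotal"
  let ?body = "block [Sub rTotal rTotal rTwo, Add rOut rOut rOne]"
  have loop: "triple (\<lambda>s. ?P s \<and> ?f s \<le> n * n) (While rTotal ?body) ((n * n + 1) * (2 + 1) + 3)
     (\<lambda>s. ?P s \<and> fst s rTotal = 0)"
  proof (rule triple_While)
    fix a
    have "triple (\<lambda>s. ?P s \<and> ?f s = a \<and> 0 < fst s rTotal) ?body (clen ?body) (\<lambda>s. ?P s \<and> ?f s < a)"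
      by (rule triple_loop_free) (simp, simp, presburger)
    then show "triple (\<lambda>s. ?P s \<and> ?f s = a \<and> 0 < fst s rTotal) ?body 2 (\<lambda>s. ?P s \<and> ?f s < a)"
      by (rule triple_conseq) simp_all
  qed simp_all
  have start: "triple (\<lambda>(r, xs). constants n k r \<and> r rTotal = 2 * v \<and> 2 * v \<le> n * n)
      (Ins (SetConst rOut 0)) (clen (Ins (SetConst rOut 0))) (\<lambda>s. ?P s \<and> ?f s \<le> n * n)"
    by (rule triple_loop_free) (auto simp: constants_def)
  from triple_Seq[OF start loop] show ?thesis
    unfolding halve_def by (rule triple_conseq) auto
qed

lemma matching_program_correct:
  assumes G: "simple_graph G" "bipartite G" "verts G = {..<n}"
  shows "triple (\<lambda>s. s = (\<lambda>_. 0, k # n # input_rows n (\<lambda>i j. {i, j} \<in> edges G) 0))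
     matching_program (matching_steps n) (\<lambda>s. fst s rOut = nu k G)"
proof -
  let ?A = "\<lambda>i j. {i, j} \<in> edges G"
  let ?P = "(\<lambda>(r, xs). constants n k r \<and> valid n k ?A (entries n r) (labels r)) :: state \<Rightarrow> bool"
  let ?f = "\<lambda>s :: state. potential n (entries n (fst s)) (labels (fst s))"
  let ?Q = "(\<lambda>(r, xs). constants n k r \<and> r rTotal = 2 * nu k G \<and> 2 * nu k G \<le> n * n) :: state \<Rightarrow> bool"
  have read: "triple (\<lambda>s. s = (\<lambda>_. 0, k # n # input_rows n ?A 0)) read_input
     ((n + 1) * ((n + 1) * 14 + 10) + 11) (\<lambda>s. ?P s \<and> ?f s \<le> n * ((n + 1) * (n + 1)))"
  proof (rule triple_conseq[OF read_input_correct])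
    fix r and xs :: "nat list"
    assume *: "case (r, xs) of (r, xs) \<Rightarrow>
      constants n k r \<and> valid n k ?A (entries n r) (labels r) \<and> (\<forall>j<n. labels r j = 0)"
    then show "?P (r, xs) \<and> ?f (r, xs) \<le> n * ((n + 1) * (n + 1))"
      by (simp add: potential_def)
  qed simp_all
  have sweeps: "triple (\<lambda>s. ?P s \<and> ?f s \<le> n * ((n + 1) * (n + 1))) (Rep sweep rFound)
     ((n * ((n + 1) * (n + 1)) + 1) * (sweep_steps n + 1)) ?Q"
  proof (rule triple_Rep, rule triple_conseq[OF sweep_correct])
    fix a r and xs :: "nat list"
    assume "?P (r, xs) \<and> ?f (r, xs) = a"
    then show "case (r, xs) of (r, xs) \<Rightarrow> constants n k r \<and> valid n k ?A (entries n r) (labels r) \<and>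
       potential n (entries n r) (labels r) = a" by simp
  next
    fix a r and xs :: "nat list"
    assume "case (r, xs) of (r, xs) \<Rightarrow> sweep_inv n k ?A a n r"
    then have inv: "sweep_inv n k ?A a n r" by simp
    show "if fst (r, xs) rFound = 0 then ?Q (r, xs) else ?P (r, xs) \<and> ?f (r, xs) < a"
    proof (cases "r rFound = 0")
      case True
      then have v: "valid n k ?A (entries n r) (labels r)" and c: "constants n k r"
        and tot: "r rTotal = (\<Sum>j<n. min (load n (entries n r) j) k)"
        and fin: "\<And>j. j < n \<Longrightarrow> load n (entries n r) j \<le> k \<or> labels r j = n + 1"
        using inv by (auto simp: sweep_inv_def)
      have eq: "(\<Sum>j<n. min (load n (entries n r) j) k) = 2 * nu k G"
        by (rule sum_min_load_eq_nu[OF G v fin])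
      have "(\<Sum>j<n. min (load n (entries n r) j) k) \<le> (\<Sum>j<n. n)"
        by (intro sum_mono) (use load_le in \<open>auto intro: min.coboundedI1\<close>)
      then show ?thesis using True c tot eq by simp
    next
      case False
      then show ?thesis using inv by (simp add: sweep_inv_def)
    qed
  qed simp
  from triple_Seq[OF read triple_Seq[OF sweeps halve_correct]]
  show ?thesis unfolding matching_program_def matching_steps_def .
qed

lemma poly_bounded_matching_steps: "poly_bounded matching_steps"
  unfolding matching_steps_def[abs_def] sweep_steps_def by (intro poly_bounded_intros)

lemma length_le_input_size: "length xs \<le> input_size xs"
  unfolding input_size_def by (induction xs) (auto simp: bit_length_def)

theorem mainTheorem3:
  "poly_time_solvable bipartite_instances encode_instance (\<lambda>(G, k). nu k G)"
proof (rule poly_time_solvableI[where c = matching_program and T = matching_steps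
      and sz = "\<lambda>(G, k). card (verts G)"])
  fix x assume "x \<in> bipartite_instances"
  then obtain G k n where x: "x = (G, k)" and G: "simple_graph G" "bipartite G" "verts G = {..<n}"
    unfolding bipartite_instances_def by blast
  have enc: "encode_instance x = k # n # input_rows n (\<lambda>i j. {i, j} \<in> edges G) 0"
    by (simp add: x encode_instance_def G(3) input_rows_def input_row_def)
  show "triple (\<lambda>s. s = (\<lambda>_. 0, encode_instance x)) matching_program
      (matching_steps ((\<lambda>(G, k). card (verts G)) x)) (\<lambda>s. fst s 0 = (\<lambda>(G, k). nu k G) x)"
    using matching_program_correct[OF G, of k] unfolding enc by (simp add: x G(3))
  have "n \<le> n * n" by (cases n) auto
  moreover have "length (encode_instance x) = n * n + 2"
    unfolding enc input_rows_def input_row_def by (simp add: length_concat comp_def sum_list_triv)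
  ultimately have "n \<le> input_size (encode_instance x)"
    using length_le_input_size[of "encode_instance x"] by linarith
  then show "(\<lambda>(G, k). card (verts G)) x \<le> input_size (encode_instance x)" by (simp add: x G(3))
qed (rule poly_bounded_matching_steps)

end
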